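(* Let $d=-1$ or $d=-3$, let $O_d$ be the ring of integers of $\mathbb Q(\sqrt d)$, and let $B_d=PSL(2,O_d)$ (which equals $PE_d$ for these $d$). Then $B_d=PE_d$ has normal non-congruence subgroups.
   Context: Let $\{1,w\}$ be an integral basis of $O_d$. $PE_d=E_d/\langle\pm I\rangle$, where $E_d$ is the subgroup of $SL(2,O_d)$ generated by $\begin{pmatrix}1&1\\0&1\end{pmatrix}$, $\begin{pmatrix}1&w\\0&1\end{pmatrix}$, $\begin{pmatrix}0&1\\-1&0\end{pmatrix}$; it is known that $PE_d=B_d$ for $d=-1,-3$. For a nonzero ideal $\pi$ of $O_d$, $B_d(\pi)=\{x\in B_d:x\equiv\pm I\pmod\pi\}$. A subgroup of $B_d$ is congruence if it contains $B_d(\pi)$ for some nonzero ideal $\pi\subseteq O_d$; a non-congruence subgroup here means a finite index subgroup that is not congruence. *)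

theory Defs
  imports
    "HOL-Analysis.Determinants"
    "HOL-Algebra.Ideal"
    "HOL-Algebra.Generated_Groups"
    "HOL-Computational_Algebra.Polynomial"
begin

definition quadratic_field :: "int \<Rightarrow> complex set" where
  "quadratic_field d = {a + b * csqrt (of_int d) | a b. a \<in> \<rat> \<and> b \<in> \<rat>}"

definition ring_of_integers :: "int \<Rightarrow> complex set" where
  "ring_of_integers d = {x \<in> quadratic_field d. algebraic_int x}"

definition OK :: "int \<Rightarrow> complex ring" where
  "OK d = \<lparr>carrier = ring_of_integers d, monoid.mult = (*), one = 1, zero = 0, add = (+)\<rparr>"

definition integral_basis :: "int \<Rightarrow> complex \<Rightarrow> bool" where
  "integral_basis d w \<longleftrightarrow> w \<in> ring_of_integers d \<and>
     (\<forall>x \<in> ring_of_integers d. \<exists>!(m :: int, n :: int). x = of_int m * 1 + of_int n * w)"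

definition SL2 :: "int \<Rightarrow> (complex^2^2) monoid" where
  "SL2 d = \<lparr>carrier = {A. (\<forall>i j. A $ i $ j \<in> ring_of_integers d) \<and> det A = 1},
            monoid.mult = (**), one = mat 1\<rparr>"

definition pm_I :: "(complex^2^2) set" where
  "pm_I = {mat 1, - mat 1}"

definition PSL2 :: "int \<Rightarrow> (complex^2^2) set monoid" where
  "PSL2 d = SL2 d Mod pm_I"

definition E2 :: "int \<Rightarrow> complex \<Rightarrow> (complex^2^2) set" where
  "E2 d w = generate (SL2 d)
     {vector [vector [1, 1], vector [0, 1]],
      vector [vector [1, w], vector [0, 1]],
      vector [vector [0, 1], vector [-1, 0]]}"

definition PE2 :: "int \<Rightarrow> complex \<Rightarrow> (complex^2^2) set monoid" where
  "PE2 d w = (SL2 d)\<lparr>carrier := E2 d w\<rparr> Mod pm_I"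

definition mat_cong :: "complex set \<Rightarrow> complex^2^2 \<Rightarrow> complex^2^2 \<Rightarrow> bool" where
  "mat_cong \<pi> A B \<longleftrightarrow> (\<forall>i j. A $ i $ j - B $ i $ j \<in> \<pi>)"

text \<open>Elements of \<open>PSL2 d\<close> are cosets \<open>{A, -A}\<close>; the condition below does not
  depend on which of the two representatives is taken.\<close>

definition principal_congruence_subgroup :: "int \<Rightarrow> complex set \<Rightarrow> (complex^2^2) set set" where
  "principal_congruence_subgroup d \<pi> =
     {X \<in> carrier (PSL2 d). \<exists>A \<in> X. mat_cong \<pi> A (mat 1) \<or> mat_cong \<pi> A (- mat 1)}"

definition congruence_subgroup :: "int \<Rightarrow> (complex^2^2) set set \<Rightarrow> bool" where
  "congruence_subgroup d H \<longleftrightarrow> subgroup H (PSL2 d) \<and>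
     (\<exists>\<pi>. ideal \<pi> (OK d) \<and> \<pi> \<noteq> {0} \<and> principal_congruence_subgroup d \<pi> \<subseteq> H)"

definition noncongruence_subgroup :: "int \<Rightarrow> (complex^2^2) set set \<Rightarrow> bool" where
  "noncongruence_subgroup d H \<longleftrightarrow> subgroup H (PSL2 d) \<and>
     finite (rcosets\<^bsub>PSL2 d\<^esub> H) \<and> \<not> congruence_subgroup d H"

end

theory Submission
  imports Defs "HOL-Combinatorics.Permutations"
begin

text \<open>Both rings are Euclidean for the complex absolute value, so \<open>SL\<^sub>2\<close> is generated by
  elementary matrices. More precisely, Cohn's argument gives a presentation of \<open>PSL\<^sub>2\<close> with
  generators \<open>U(x)\<close>, \<open>S\<close> and \<open>D(\<epsilon>)\<close>: a matrix is decomposed by the Euclidean algorithm, and two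
  choices of the quotient are connected by steps of absolute value 1, for each of which the value
  is controlled by the relation for \<open>S U(\<epsilon>) S\<close>. The presentation turns permutations satisfying
  finitely many relations into actions of \<open>PSL\<^sub>2\<close>, here on 5 points (with image \<open>S\<^sub>5\<close>) and on
  22 points (with image \<open>A\<^sub>2\<^sub>2\<close>).

  In such an action let \<open>U(x)\<close> and \<open>U(y)\<close> have coprime orders \<open>p\<close> and \<open>q\<close>. If the kernel contained
  the principal congruence subgroup of level \<open>n\<close>, choose an integer \<open>e\<close> that is idempotent modulo
  \<open>n\<close>, 1 modulo \<open>p\<close> and 0 modulo \<open>q\<close>. Then \<open>U(ex)\<close> and \<open>S U((1-e)y) S\<^sup>-\<^sup>1\<close> commute modulo \<open>n\<close>,
  but they act like \<open>U(x)\<close> and \<open>S U(y) S\<^sup>-\<^sup>1\<close>, which do not commute.\<close>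

section \<open>The rings of Gaussian and Eisenstein integers\<close>

text \<open>Here \<open>t\<close> is the trace of \<open>\<zeta>\<close>, a primitive fourth or
  sixth root of unity, so both rings share the equation
  \<open>\<zeta> * \<zeta> = t * \<zeta> - 1\<close>. The order of \<open>\<zeta>\<close> is
  \<open>2 * (2 + t)\<close> and the field is generated by a square root of
  \<open>- 1 - 2 * t\<close>.\<close>

locale euclidean_quadratic =
  fixes t :: int and \<zeta> :: complex
  assumes cases: "t = 0 \<and> \<zeta> = \<i> \<or> t = 1 \<and> \<zeta> = Complex (1/2) (sqrt 3 / 2)"
begin

definition \<O> :: "complex set" where
  "\<O> = {of_int m + of_int n * \<zeta> | m n. True}"

lemma t_cases: "t = 0 \<or> t = 1"
  using cases by blast

lemma Re_zeta: "Re \<zeta> = of_int t / 2"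
  using cases by auto

lemma Im_zeta_pos: "Im \<zeta> > 0"
  using cases by auto

lemma Im_zeta_sq: "(Im \<zeta>)\<^sup>2 = 1 - of_int t / 4"
  using cases by (auto simp: power_divide)

lemma cmod_zeta [simp]: "cmod \<zeta> = 1"
proof -
  have "(cmod \<zeta>)\<^sup>2 = 1"
    using t_cases by (auto simp: cmod_power2 Re_zeta Im_zeta_sq power_divide)
  then show ?thesis by (simp add: power2_eq_1_iff) (smt (verit) norm_ge_zero)
qed

lemma zeta_neq_0 [simp]: "\<zeta> \<noteq> 0"
  using cmod_zeta by fastforce

lemma zeta_square: "\<zeta> * \<zeta> = of_int t * \<zeta> - 1"
  using Im_zeta_sq t_cases by (auto simp: complex_eq_iff Re_zeta power2_eq_square)

lemma cnj_zeta: "cnj \<zeta> = of_int t - \<zeta>"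
  using Re_zeta by (simp add: complex_eq_iff)

lemma zeta_cnj: "\<zeta> * (of_int t - \<zeta>) = 1"
  by (simp add: algebra_simps zeta_square)

lemma inverse_zeta: "1 / \<zeta> = of_int t - \<zeta>"
  using zeta_cnj by (simp add: divide_eq_eq mult.commute)

lemma in_O: "of_int m + of_int n * \<zeta> \<in> \<O>"
  by (auto simp: \<O>_def)

lemma O_cases:
  assumes "x \<in> \<O>"
  obtains m n where "x = of_int m + of_int n * \<zeta>"
  using assms by (auto simp: \<O>_def)

lemma of_int_O [simp]: "of_int m \<in> \<O>"
  using in_O[of m 0] by simp

lemma O_0 [simp]: "0 \<in> \<O>" and O_1 [simp]: "1 \<in> \<O>" and zeta_O [simp]: "\<zeta> \<in> \<O>"
  using in_O[of 0 0] in_O[of 1 0] in_O[of 0 1] by auto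

lemma O_add [simp]: "x \<in> \<O> \<Longrightarrow> y \<in> \<O> \<Longrightarrow> x + y \<in> \<O>"
proof (elim O_cases)
  fix m n m' n' assume "x = of_int m + of_int n * \<zeta>" "y = of_int m' + of_int n' * \<zeta>"
  then show ?thesis using in_O[of "m + m'" "n + n'"] by (simp add: algebra_simps)
qed

lemma O_uminus [simp]: "x \<in> \<O> \<Longrightarrow> - x \<in> \<O>"
proof (elim O_cases)
  fix m n assume "x = of_int m + of_int n * \<zeta>"
  then show ?thesis using in_O[of "- m" "- n"] by (simp add: algebra_simps)
qed

lemma O_diff [simp]: "x \<in> \<O> \<Longrightarrow> y \<in> \<O> \<Longrightarrow> x - y \<in> \<O>"
  using O_add[of x "- y"] by simp

lemma O_mult [simp]: "x \<in> \<O> \<Longrightarrow> y \<in> \<O> \<Longrightarrow> x * y \<in> \<O>"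
proof (elim O_cases)
  fix m n m' n' assume xy: "x = of_int m + of_int n * \<zeta>" "y = of_int m' + of_int n' * \<zeta>"
  have "x * y = of_int (m * m') + of_int (m * n' + n * m') * \<zeta> + of_int (n * n') * (\<zeta> * \<zeta>)"
    by (simp add: xy algebra_simps)
  also have "\<dots> = of_int (m * m' - n * n') + of_int (m * n' + n * m' + t * (n * n')) * \<zeta>"
    by (simp add: zeta_square algebra_simps)
  finally show ?thesis using in_O by metis
qed

lemma O_cnj [simp]: "x \<in> \<O> \<Longrightarrow> cnj x \<in> \<O>"
  by (elim O_cases) (simp add: cnj_zeta)

lemma cmod_O: "(cmod (of_int m + of_int n * \<zeta>))\<^sup>2 = of_int (m\<^sup>2 + t * m * n + n\<^sup>2)"
proof -
  have "(cmod (of_int m + of_int n * \<zeta>))\<^sup>2 = (of_int m + of_int n * Re \<zeta>)\<^sup>2 + (of_int n)\<^sup>2 * (Im \<zeta>)\<^sup>2"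
    by (simp add: cmod_power2 power_mult_distrib)
  also have "\<dots> = of_int (m\<^sup>2 + t * m * n + n\<^sup>2)"
    unfolding Im_zeta_sq Re_zeta using t_cases
    by (auto simp: power2_eq_square field_simps)
  finally show ?thesis .
qed

lemma cmod_O_nat:
  assumes "x \<in> \<O>"
  obtains k :: nat where "(cmod x)\<^sup>2 = of_nat k"
proof -
  obtain m n where x: "x = of_int m + of_int n * \<zeta>" using assms by (rule O_cases)
  let ?k = "m\<^sup>2 + t * m * n + n\<^sup>2"
  have "(cmod x)\<^sup>2 = of_int ?k" by (simp only: x cmod_O)
  moreover from this have "?k \<ge> 0" by (metis of_int_0_le_iff zero_le_power2)
  ultimately have "(cmod x)\<^sup>2 = of_nat (nat ?k)" by simp
  then show thesis using that by blast
qed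

text \<open>Rounding first the \<open>\<zeta>\<close>-coordinate and then the remaining real part
  leaves errors of at most 1/2 in both directions, because \<open>Im \<zeta> \<le> 1\<close>; the
  squared distance is at most 1/2.\<close>

lemma covering: "\<exists>q\<in>\<O>. cmod (z - q) < 1"
proof -
  define n where "n = round (Im z / Im \<zeta>)"
  define m where "m = round (Re z - of_int n * Re \<zeta>)"
  let ?q = "of_int m + of_int n * \<zeta>"
  have n: "\<bar>Im z / Im \<zeta> - of_int n\<bar> \<le> 1/2"
    unfolding n_def using of_int_round_abs_le[of "Im z / Im \<zeta>"] by (simp add: abs_minus_commute)
  have m: "\<bar>Re z - of_int n * Re \<zeta> - of_int m\<bar> \<le> 1/2"
    unfolding m_def using of_int_round_abs_le by (metis abs_minus_commute)
  have "Im (z - ?q) = (Im z / Im \<zeta> - of_int n) * Im \<zeta>"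
    using Im_zeta_pos by (simp add: algebra_simps)
  then have "(Im (z - ?q))\<^sup>2 = (Im z / Im \<zeta> - of_int n)\<^sup>2 * (Im \<zeta>)\<^sup>2"
    by (simp add: power_mult_distrib)
  also have "\<dots> \<le> (1/2)\<^sup>2 * 1"
    by (rule mult_mono) (use n t_cases in \<open>auto simp: Im_zeta_sq abs_le_square_iff[symmetric] simp del: power2_eq_square\<close>)
  finally have "(Im (z - ?q))\<^sup>2 \<le> 1/4" by (simp add: power2_eq_square)
  moreover have "Re (z - ?q) = Re z - of_int n * Re \<zeta> - of_int m" by simp
  then have "(Re (z - ?q))\<^sup>2 \<le> (1/2)\<^sup>2"
    using m by (metis abs_le_square_iff abs_of_nonneg zero_le_divide_1_iff zero_le_numeral)
  ultimately have "(cmod (z - ?q))\<^sup>2 < 1\<^sup>2"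
    unfolding cmod_power2 by (simp add: power_divide)
  then have "cmod (z - ?q) < 1" using power2_less_imp_less by fastforce
  then show ?thesis using in_O by blast
qed

text \<open>The only norm strictly between 1 and 4 is \<open>2 + t\<close>, the norm of
  \<open>1 + \<zeta>\<close>, and all elements of this norm are associates of
  \<open>1 + \<zeta>\<close>. Geometrically, such a \<open>\<delta>\<close> is a diagonal of the
  rhombus with sides \<open>e\<close> and \<open>e * \<zeta>\<close>.\<close>

lemma div_1_zeta:
  assumes "\<delta> \<in> \<O>" and "(cmod \<delta>)\<^sup>2 < 4" and "\<delta> \<noteq> 0" and "cmod \<delta> \<noteq> 1"
  shows "\<exists>e\<in>\<O>. cmod e = 1 \<and> \<delta> = e * (1 + \<zeta>)"
proof -
  obtain m n where \<delta>: "\<delta> = of_int m + of_int n * \<zeta>" using assms(1) by (rule O_cases)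
  let ?k = "m\<^sup>2 + t * m * n + n\<^sup>2"
  have k: "(cmod \<delta>)\<^sup>2 = of_int ?k" by (simp only: \<delta> cmod_O)
  have "?k < 4" using assms(2) k by linarith
  have "?k \<noteq> 0" using assms(3) k by fastforce
  have "?k \<noteq> 1"
  proof
    assume "?k = 1"
    then have "(cmod \<delta>)\<^sup>2 = 1" using k by simp
    then show False using assms(4) by (simp add: power2_eq_1_iff) (smt (verit) norm_ge_zero)
  qed
  have "2 * ?k \<ge> m\<^sup>2 + n\<^sup>2"
  proof (cases "t = 0")
    case True then show ?thesis by simp
  next
    case False
    then have "2 * ?k = m\<^sup>2 + n\<^sup>2 + (m + n)\<^sup>2"
      using t_cases by (simp add: power2_eq_square algebra_simps)
    then show ?thesis by simp
  qed
  then have "m\<^sup>2 < 9" "n\<^sup>2 < 9" using \<open>?k < 4\<close> by (smt (verit) zero_le_power2)+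
  then have "\<bar>m\<bar> < 3" "\<bar>n\<bar> < 3"
    using power2_less_imp_less[of "\<bar>m\<bar>" 3] power2_less_imp_less[of "\<bar>n\<bar>" 3] by auto
  then have "m \<in> {-2,-1,0,1,2}" "n \<in> {-2,-1,0,1,2}" by auto
  \<comment> \<open>The witnesses are the coordinates of
    \<open>\<delta> * cnj (1 + \<zeta>) / (2 + t)\<close>, that is, of
    \<open>\<delta> / (1 + \<zeta>)\<close>.\<close>
  then have "\<exists>a b. a\<^sup>2 + t * a * b + b\<^sup>2 = 1 \<and> m = a - b \<and> n = a + b + t * b"
    using t_cases \<open>?k < 4\<close> \<open>?k \<noteq> 0\<close> \<open>?k \<noteq> 1\<close>
    apply (elim disjE)
    subgoal
      apply (rule exI[of _ "(m + n) div 2"], rule exI[of _ "(n - m) div 2"])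
      by auto
    subgoal
      apply (rule exI[of _ "(2 * m + n) div 3"], rule exI[of _ "(n - m) div 3"])
      by auto
    done
  then obtain a b where ab: "a\<^sup>2 + t * a * b + b\<^sup>2 = 1" "m = a - b" "n = a + b + t * b"
    by blast
  let ?e = "of_int a + of_int b * \<zeta> :: complex"
  have "(cmod ?e)\<^sup>2 = 1" by (simp only: cmod_O ab of_int_1)
  then have "cmod ?e = 1" by (simp add: power2_eq_1_iff) (smt (verit) norm_ge_zero)
  moreover have "\<delta> = ?e * (1 + \<zeta>)"
  proof -
    have "?e * (1 + \<zeta>) = of_int a + of_int (a + b) * \<zeta> + of_int b * (\<zeta> * \<zeta>)"
      by (simp add: algebra_simps)
    then show ?thesis by (simp add: zeta_square \<delta> ab algebra_simps)
  qed
  ultimately show ?thesis using in_O by blast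
qed

text \<open>Two lattice points whose unit discs share a point span, when they are not adjacent, the
  diagonal of a rhombus of side 1. One of the other two corners then also lies within distance
  1 of that point, since the sum of squared distances to them is not larger.\<close>

lemma lens:
  assumes "q \<in> \<O>" "q' \<in> \<O>" and z: "cmod (z - q) < 1" "cmod (z - q') \<le> 1"
  shows "q = q' \<or> cmod (q - q') = 1 \<or>
    (\<exists>p\<in>\<O>. cmod (z - p) < 1 \<and> cmod (p - q) = 1 \<and> cmod (p - q') = 1)"
proof (rule ccontr)
  assume *: "\<not> ?thesis"
  have "cmod (q' - q) < 2"
    using norm_triangle_ineq4[of "z - q" "z - q'"] z by simp
  then have "(cmod (q' - q))\<^sup>2 < 2\<^sup>2"
    by (intro power_strict_mono) auto
  then obtain e where e: "e \<in> \<O>" "cmod e = 1" "q' - q = e * (1 + \<zeta>)"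
    using div_1_zeta[of "q' - q"] assms * by (auto simp: norm_minus_commute)
  then have q': "q' = q + e + e * \<zeta>" by (simp add: algebra_simps)
  have "cmod (z - (q + e)) < 1 \<or> cmod (z - (q + e * \<zeta>)) < 1"
  proof (rule ccontr)
    assume "\<not> ?thesis"
    then have "(cmod (z - (q + e)))\<^sup>2 \<ge> 1\<^sup>2" "(cmod (z - (q + e * \<zeta>)))\<^sup>2 \<ge> 1\<^sup>2"
      by (auto intro!: power_mono simp del: power_one)
    moreover have "(cmod (z - q))\<^sup>2 < 1\<^sup>2" "(cmod (z - q'))\<^sup>2 \<le> 1\<^sup>2"
      using z by (auto intro!: power_strict_mono power_mono simp del: power_one)
    \<comment> \<open>The last term is twice the inner product of the sides \<open>e\<close> and
      \<open>e * \<zeta>\<close>; it equals \<open>t\<close>, hence is nonnegative.\<close>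
    moreover have "(cmod (z - q))\<^sup>2 + (cmod (z - q'))\<^sup>2
        = (cmod (z - (q + e)))\<^sup>2 + (cmod (z - (q + e * \<zeta>)))\<^sup>2 + 2 * Re (e * cnj (e * \<zeta>))"
      unfolding q' cmod_power2 by (simp add: algebra_simps power2_eq_square)
    moreover have "Re (e * cnj (e * \<zeta>)) = Re ((e * cnj e) * cnj \<zeta>)"
      by (simp only: complex_cnj_mult mult.assoc)
    moreover have "e * cnj e = 1"
      using e(2) complex_norm_square[of e] by simp
    ultimately show False using Re_zeta t_cases by auto
  qed
  then show False
  proof
    assume "cmod (z - (q + e)) < 1"
    then show False using * e assms by (auto simp: q' norm_mult norm_minus_commute dest!: bspec[of _ _ "q + e"])
  next
    assume "cmod (z - (q + e * \<zeta>)) < 1"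
    then show False using * e assms by (auto simp: q' norm_mult norm_minus_commute dest!: bspec[of _ _ "q + e * \<zeta>"])
  qed
qed

section \<open>Units, norms and the steps of the Euclidean algorithm\<close>

definition unit :: "complex \<Rightarrow> bool" where
  "unit \<epsilon> \<longleftrightarrow> \<epsilon> \<in> \<O> \<and> cmod \<epsilon> = 1"

lemma unit_1 [simp]: "unit 1" and unit_m1 [simp]: "unit (- 1)"
  by (simp_all add: unit_def)

lemma unit_O: "unit \<epsilon> \<Longrightarrow> \<epsilon> \<in> \<O>"
  by (simp add: unit_def)

lemma unit_neq_0: "unit \<epsilon> \<Longrightarrow> \<epsilon> \<noteq> 0"
  by (auto simp: unit_def)

lemma unit_inverse: "unit \<epsilon> \<Longrightarrow> unit (1 / \<epsilon>)"
  unfolding unit_def using O_cnj[of \<epsilon>]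
  by (simp add: divide_conv_cnj norm_divide)

lemma unit_mult: "unit \<epsilon> \<Longrightarrow> unit \<eta> \<Longrightarrow> unit (\<epsilon> * \<eta>)"
  by (simp add: unit_def norm_mult)

lemma unit_divide_O: "unit \<epsilon> \<Longrightarrow> x \<in> \<O> \<Longrightarrow> x / \<epsilon> \<in> \<O>"
  using O_mult[OF unit_O[OF unit_inverse] , of \<epsilon> x] by simp

lemma unit_cmod_mult: "unit \<epsilon> \<Longrightarrow> cmod (\<epsilon> * x) = cmod x"
  by (simp add: unit_def norm_mult)

lemma unit_cmod_divide: "unit \<epsilon> \<Longrightarrow> cmod (x / \<epsilon>) = cmod x"
  by (simp add: unit_def norm_divide)

lemma unit_if_mult_1:
  assumes "x \<in> \<O>" "y \<in> \<O>" "x * y = 1"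
  shows "unit x"
proof -
  obtain j k :: nat where jk: "(cmod x)\<^sup>2 = of_nat j" "(cmod y)\<^sup>2 = of_nat k"
    using assms(1,2) by (elim cmod_O_nat) blast
  have "cmod x * cmod y = 1"
    using assms(3) by (metis norm_mult norm_one)
  then have "(cmod x)\<^sup>2 * (cmod y)\<^sup>2 = 1"
    by (simp flip: power_mult_distrib)
  then have "j * k = 1"
    unfolding jk by (metis of_nat_1 of_nat_eq_iff of_nat_mult)
  then have "(cmod x)\<^sup>2 = 1" using jk by simp
  then show ?thesis using assms(1)
    by (simp add: unit_def power2_eq_1_iff) (smt (verit) norm_ge_zero)
qed

text \<open>The norm as a natural number, to serve as a measure for induction; the floor is exact on
  \<open>\<O>\<close>.\<close>

definition nn :: "complex \<Rightarrow> nat" where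
  "nn x = nat \<lfloor>(cmod x)\<^sup>2\<rfloor>"

lemma of_nat_nn: "x \<in> \<O> \<Longrightarrow> of_nat (nn x) = (cmod x)\<^sup>2"
  by (elim cmod_O_nat) (simp add: nn_def)

lemma nn_less: "x \<in> \<O> \<Longrightarrow> y \<in> \<O> \<Longrightarrow> cmod x < cmod y \<Longrightarrow> nn x < nn y"
  using of_nat_nn[of x] of_nat_nn[of y] power_strict_mono[of "cmod x" "cmod y" 2]
  by (metis norm_ge_zero of_nat_less_iff pos2)

lemma nn_cong: "cmod x = cmod y \<Longrightarrow> nn x = nn y"
  by (simp add: nn_def)

definition SL :: "complex \<Rightarrow> complex \<Rightarrow> complex \<Rightarrow> complex \<Rightarrow> bool" where
  "SL a b c d \<longleftrightarrow> a \<in> \<O> \<and> b \<in> \<O> \<and> c \<in> \<O> \<and> d \<in> \<O> \<and> a * d - b * c = 1"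

lemma SL_U: "SL a b c d \<Longrightarrow> x \<in> \<O> \<Longrightarrow> SL (a + x * c) (b + x * d) c d"
  by (simp add: SL_def algebra_simps)

lemma SL_S: "SL a b c d \<Longrightarrow> SL c d (- a) (- b)"
  by (simp add: SL_def algebra_simps)

lemma SL_D: "SL a b c d \<Longrightarrow> unit \<epsilon> \<Longrightarrow> SL (\<epsilon> * a) (\<epsilon> * b) (c / \<epsilon>) (d / \<epsilon>)"
  by (simp add: SL_def unit_O unit_divide_O unit_neq_0)

text \<open>For A = (a, b; c, d) this is the matrix \<open>S\<^sup>-\<^sup>1 U(-q) A\<close>: its
  lower left entry is the remainder of \<open>a\<close> modulo \<open>c\<close>, and A is recovered
  as U(q) S times it.\<close>

lemma SL_step: "SL a b c d \<Longrightarrow> q \<in> \<O> \<Longrightarrow> SL (- c) (- d) (a - q * c) (b - q * d)"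
  by (simp add: SL_def algebra_simps)

lemma euclid:
  assumes "a \<in> \<O>" "c \<in> \<O>" "c \<noteq> 0"
  shows "\<exists>q\<in>\<O>. cmod (a - q * c) < cmod c"
proof -
  obtain q where q: "q \<in> \<O>" "cmod (a / c - q) < 1" using covering by blast
  have "a - q * c = (a / c - q) * c" using assms(3) by (simp add: field_simps)
  then have "cmod (a - q * c) = cmod (a / c - q) * cmod c" by (simp add: norm_mult)
  also have "\<dots> < 1 * cmod c" using q assms(3) by (intro mult_strict_right_mono) auto
  finally show ?thesis using q(1) by auto
qed

text \<open>An arbitrary admissible quotient; the first clause of \<open>good\<close> expresses that
  the choice is immaterial for \<open>phi\<close>.\<close>

definition quotient :: "complex \<Rightarrow> complex \<Rightarrow> complex" where
  "quotient a c = (SOME q. q \<in> \<O> \<and> cmod (a - q * c) < cmod c)"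

lemma quotient:
  assumes "a \<in> \<O>" "c \<in> \<O>" "c \<noteq> 0"
  shows "quotient a c \<in> \<O>" "cmod (a - quotient a c * c) < cmod c"
  using someI_ex[of "\<lambda>q. q \<in> \<O> \<and> cmod (a - q * c) < cmod c"] euclid[OF assms]
  unfolding quotient_def by blast+

text \<open>This is \<open>lens\<close> scaled by \<open>c\<close>: two admissible quotients are
  joined by at most two unit steps through admissible quotients. The weak inequality for
  \<open>q'\<close> covers the borderline quotient 0 when \<open>cmod a = cmod c\<close>, which is
  needed in \<open>good_S\<close>.\<close>

lemma quotient_lens:
  assumes "q \<in> \<O>" "q' \<in> \<O>" "c \<noteq> 0" "cmod (a - q * c) < cmod c" "cmod (a - q' * c) \<le> cmod c"
  shows "q = q' \<or> unit (q' - q) \<or>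
    (\<exists>p\<in>\<O>. cmod (a - p * c) < cmod c \<and> unit (p - q) \<and> unit (q' - p))"
proof -
  have *: "cmod (a / c - p) = cmod (a - p * c) / cmod c" for p
    using assms(3) by (simp add: field_simps flip: norm_divide)
  show ?thesis
    using lens[of q q' "a / c"] assms unfolding * unit_def
    by (auto simp: norm_minus_commute)
qed

end

section \<open>Extending an action of the generators\<close>

text \<open>The parameters are the images of the matrices \<open>(1, x; 0, 1)\<close>, \<open>(0, 1; -1, 0)\<close> and
  \<open>(\<epsilon>, 0; 0, 1/\<epsilon>)\<close>; the last relation is the identity
  \<open>U(\<eta>) S U(1/\<eta>) S\<^sup>-\<^sup>1 U(\<eta>) = D(\<eta>) S\<close> for \<open>\<eta> = 1/\<epsilon>\<close>, up to sign.\<close>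

locale sl2_relations = euclidean_quadratic +
  fixes u :: "complex \<Rightarrow> 'a \<Rightarrow> 'a" and s :: "'a \<Rightarrow> 'a" and D :: "complex \<Rightarrow> 'a \<Rightarrow> 'a"
  assumes u_0 [simp]: "u 0 = id"
    and u_add: "x \<in> \<O> \<Longrightarrow> y \<in> \<O> \<Longrightarrow> u (x + y) = u x \<circ> u y"
    and s_s: "s \<circ> s = id"
    and D_1 [simp]: "D 1 = id"
    and D_m1 [simp]: "D (- 1) = id"
    and D_mult: "unit \<epsilon> \<Longrightarrow> unit \<eta> \<Longrightarrow> D (\<epsilon> * \<eta>) = D \<epsilon> \<circ> D \<eta>"
    and D_u: "unit \<epsilon> \<Longrightarrow> x \<in> \<O> \<Longrightarrow> D \<epsilon> \<circ> u x = u (\<epsilon> * \<epsilon> * x) \<circ> D \<epsilon>"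
    and s_D: "unit \<epsilon> \<Longrightarrow> s \<circ> D \<epsilon> = D (1 / \<epsilon>) \<circ> s"
    and s_u_s: "unit \<epsilon> \<Longrightarrow> s \<circ> u \<epsilon> \<circ> s = u (- 1 / \<epsilon>) \<circ> D (1 / \<epsilon>) \<circ> s \<circ> u (- 1 / \<epsilon>)"
begin

text \<open>The word read off from the Euclidean algorithm: A = U(q) S A' with A' as in
  \<open>SL_step\<close>, ending with A = U(ab) D(a) when \<open>c = 0\<close>. The default
  \<open>id\<close> outside \<open>SL\<close> confines the recursion to entries in
  \<open>\<O>\<close>, where remainders decrease.\<close>

function phi :: "complex \<Rightarrow> complex \<Rightarrow> complex \<Rightarrow> complex \<Rightarrow> 'a \<Rightarrow> 'a" where
  "phi a b c d = (if \<not> SL a b c d then id else if c = 0 then u (a * b) \<circ> D a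
     else u (quotient a c) \<circ> s \<circ> phi (- c) (- d) (a - quotient a c * c) (b - quotient a c * d))"
  by pat_completeness auto
termination
  by (relation "measure (\<lambda>(a, b, c, d). nn c)")
    (use quotient nn_less in \<open>auto simp: SL_def\<close>)

declare phi.simps [simp del]

lemma phi_upper: "SL a b 0 d \<Longrightarrow> phi a b 0 d = u (a * b) \<circ> D a"
  by (simp add: phi.simps)

text \<open>The induction statement: independence of the quotient, and compatibility with left
  multiplication by U(x) and D(\<epsilon>). Compatibility with S is left out, since the lower left
  entry of S A is \<open>- a\<close>, whose norm is not bounded by that of \<open>c\<close>.\<close>

definition good :: "complex \<Rightarrow> complex \<Rightarrow> complex \<Rightarrow> complex \<Rightarrow> bool" where
  "good a b c d \<longleftrightarrow>
     (\<forall>q\<in>\<O>. cmod (a - q * c) < cmod c \<longrightarrow>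
        phi a b c d = u q \<circ> s \<circ> phi (- c) (- d) (a - q * c) (b - q * d)) \<and>
     (\<forall>x\<in>\<O>. phi (a + x * c) (b + x * d) c d = u x \<circ> phi a b c d) \<and>
     (\<forall>\<epsilon>. unit \<epsilon> \<longrightarrow> phi (\<epsilon> * a) (\<epsilon> * b) (c / \<epsilon>) (d / \<epsilon>) = D \<epsilon> \<circ> phi a b c d)"

lemma good_step:
  "good a b c d \<Longrightarrow> q \<in> \<O> \<Longrightarrow> cmod (a - q * c) < cmod c \<Longrightarrow>
     phi a b c d = u q \<circ> s \<circ> phi (- c) (- d) (a - q * c) (b - q * d)"
  unfolding good_def by blast

lemma good_U: "good a b c d \<Longrightarrow> x \<in> \<O> \<Longrightarrow> phi (a + x * c) (b + x * d) c d = u x \<circ> phi a b c d"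
  unfolding good_def by blast

lemma good_D:
  "good a b c d \<Longrightarrow> unit \<epsilon> \<Longrightarrow> phi (\<epsilon> * a) (\<epsilon> * b) (c / \<epsilon>) (d / \<epsilon>) = D \<epsilon> \<circ> phi a b c d"
  unfolding good_def by blast

lemma good_uminus: "good a b c d \<Longrightarrow> phi (- a) (- b) (- c) (- d) = phi a b c d"
  using good_D[of a b c d "- 1"] by simp

section \<open>Independence of the quotients and compatibility with S\<close>

lemma s_comp_s: "s \<circ> (s \<circ> f) = f"
  by (simp add: s_s flip: comp_assoc)

text \<open>With N = (-c, -d; r, r'), the matrix (-c, -d; a, b) is S U(\<eta>) S N up to sign.
  Replacing S U(\<eta>) S by the word in relation \<open>s_u_s\<close> splits the passage into
  multiplications by U, S, D and U; the three goodness assumptions cover all of them but S, which is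
  the assumption \<open>S\<close>.\<close>

lemma good_twist:
  assumes "SL a b c d" "unit \<eta>"
    and r: "r = a - \<eta> * c" "r' = b - \<eta> * d"
    and "good (- c) (- d) r r'" "good r r' (a / \<eta>) (b / \<eta>)" "good (r / \<eta>) (r' / \<eta>) a b"
    and S: "phi r r' (a / \<eta>) (b / \<eta>) = s \<circ> phi (- (a / \<eta>)) (- (b / \<eta>)) r r'"
  shows "phi (- c) (- d) a b = s \<circ> u \<eta> \<circ> s \<circ> phi (- c) (- d) r r'"
proof -
  have [simp]: "\<eta> \<noteq> 0" and \<eta>': "unit (1 / \<eta>)"
    using assms(2) unit_inverse unit_neq_0 by auto
  have [simp]: "- (1 / \<eta>) \<in> \<O>"
    by (rule O_uminus[OF unit_O[OF \<eta>']])
  have "phi (- c) (- d) a b = phi (r / \<eta> + (- 1 / \<eta>) * a) (r' / \<eta> + (- 1 / \<eta>) * b) a b"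
    by (simp add: r diff_divide_distrib)
  also have "\<dots> = u (- 1 / \<eta>) \<circ> phi (r / \<eta>) (r' / \<eta>) a b"
    by (rule good_U) (use assms in auto)
  also have "phi (r / \<eta>) (r' / \<eta>) a b
      = phi (1 / \<eta> * r) (1 / \<eta> * r') ((a / \<eta>) / (1 / \<eta>)) ((b / \<eta>) / (1 / \<eta>))"
    by simp
  also have "\<dots> = D (1 / \<eta>) \<circ> phi r r' (a / \<eta>) (b / \<eta>)"
    by (rule good_D) (use assms \<eta>' in auto)
  also note S
  also have "phi (- (a / \<eta>)) (- (b / \<eta>)) r r'
      = phi (- c + (- 1 / \<eta>) * r) (- d + (- 1 / \<eta>) * r') r r'"
    by (simp add: r diff_divide_distrib)
  also have "\<dots> = u (- 1 / \<eta>) \<circ> phi (- c) (- d) r r'"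
    by (rule good_U) (use assms in auto)
  finally show ?thesis
    unfolding s_u_s[OF assms(2)] by (simp add: fun_eq_iff)
qed

lemma good_S_less:
  assumes "good a b c d" "good c d (- a) (- b)" "cmod a < cmod c"
  shows "phi c d (- a) (- b) = s \<circ> phi a b c d"
  using good_step[OF assms(1), of 0] good_uminus[OF assms(2)] assms(3)
  by (simp add: s_comp_s)

text \<open>The quotient 0 is admissible for A if \<open>cmod a < cmod c\<close>, and for S A if
  \<open>cmod c < cmod a\<close>. In both cases the Euclidean step with quotient 0 is an application
  of \<open>s\<close>.\<close>

lemma good_S_neq:
  assumes "good a b c d" "good c d (- a) (- b)" "cmod a \<noteq> cmod c"
    and "SL a b c d"
  shows "phi c d (- a) (- b) = s \<circ> phi a b c d"
proof (cases "cmod a < cmod c")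
  case True
  then show ?thesis using good_S_less assms by blast
next
  case False
  have "phi c d (- a) (- b) = u 0 \<circ> s \<circ> phi a b c d"
    using good_step[OF assms(2), of 0] False assms(3) good_uminus[OF assms(1)] by auto
  then show ?thesis by simp
qed

text \<open>If \<open>cmod a = cmod c\<close>, the quotient 0 just fails to be admissible, and
  \<open>quotient_lens\<close> yields an admissible unit \<eta>. Then A = U(\<eta>) S N with N as in
  \<open>good_twist\<close>, so that lemma computes the value at S A. Goodness is assumed only below
  the bound \<open>k\<close>, which allows use inside the induction that proves
  \<open>good\<close>.\<close>

lemma good_S:
  assumes IH: "\<And>a b c d. SL a b c d \<Longrightarrow> nn c < k \<Longrightarrow> good a b c d"
    and SL: "SL a b c d" and "nn a < k" "nn c < k"
  shows "phi c d (- a) (- b) = s \<circ> phi a b c d"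
proof (cases "cmod a = cmod c")
  case False
  then show ?thesis
    by (intro good_S_neq IH) (use assms SL_S[OF SL] in \<open>auto simp: nn_def\<close>)
next
  case True
  have [simp]: "c \<noteq> 0" "a \<in> \<O>" "b \<in> \<O>" "c \<in> \<O>" "d \<in> \<O>"
    using SL True by (auto simp: SL_def)
  obtain \<eta> where \<eta>: "unit \<eta>" "cmod (a - \<eta> * c) < cmod c"
  proof -
    obtain q where q: "q \<in> \<O>" "cmod (a - q * c) < cmod c" using euclid[of a c] by auto
    have "q \<noteq> 0" using q True by auto
    have "unit x" if "unit (- x)" for x using unit_mult[OF unit_m1 that] by simp
    then show thesis
      using quotient_lens[of q 0 c a] q True \<open>q \<noteq> 0\<close> that by (auto dest: O_uminus)
  qed
  define r r' where "r = a - \<eta> * c" and "r' = b - \<eta> * d"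
  have [simp]: "\<eta> \<noteq> 0" using \<eta> unit_neq_0 by blast
  have SL1: "SL (- c) (- d) r r'"
    unfolding r_def r'_def by (rule SL_step) (use SL \<eta> unit_O in auto)
  have r: "r \<in> \<O>" "nn r < k"
    using SL1 nn_less[of r c] \<eta>(2) \<open>nn c < k\<close> by (auto simp: SL_def r_def)
  have SL2: "SL (- (a / \<eta>)) (- (b / \<eta>)) r r'"
    using SL_U[OF SL1, of "- (1 / \<eta>)"] unit_O[OF unit_inverse[OF \<eta>(1)]]
    by (simp add: r_def r'_def diff_divide_distrib)
  have SL3: "SL r r' (a / \<eta>) (b / \<eta>)"
    using SL_S[OF SL2] by simp
  have SL4: "SL (r / \<eta>) (r' / \<eta>) a b"
    using SL_D[OF SL3 unit_inverse[OF \<eta>(1)]] by simp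
  have nn: "nn (a / \<eta>) < k"
    using \<open>nn a < k\<close> nn_cong[OF unit_cmod_divide[OF \<eta>(1)]] by metis
  have "phi (- c) (- d) a b = s \<circ> u \<eta> \<circ> s \<circ> phi (- c) (- d) r r'"
  proof (rule good_twist[OF SL \<eta>(1) r_def r'_def])
    have "cmod r \<noteq> cmod (a / \<eta>)"
      using \<eta> True unit_cmod_divide r_def by auto
    then show "phi r r' (a / \<eta>) (b / \<eta>) = s \<circ> phi (- (a / \<eta>)) (- (b / \<eta>)) r r'"
      using good_S_neq[OF IH[OF SL2 r(2)] _ _ SL2] IH[OF SL3 nn] by simp
  qed (use IH SL1 SL3 SL4 r nn \<open>nn a < k\<close> in blast)+
  moreover have "phi a b c d = u \<eta> \<circ> s \<circ> phi (- c) (- d) r r'"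
    unfolding r_def r'_def by (rule good_step) (use IH SL assms \<eta> unit_O in blast)+
  moreover have "phi (- c) (- d) a b = phi c d (- a) (- b)"
    using good_uminus[OF IH[OF SL_S[OF SL]]] \<open>nn a < k\<close> by (simp add: nn_def)
  ultimately show ?thesis by (simp add: comp_assoc)
qed

text \<open>Write \<open>q' = q + \<eta>\<close>. After cancelling \<open>u q\<close> and one
  \<open>s\<close>, the claim is \<open>good_twist\<close> for the matrix (r, r'; c, d); all lower
  left entries that occur there are associates of the remainders \<open>r\<close> and
  \<open>r1\<close>, hence of smaller norm than \<open>c\<close>.\<close>

lemma step_unit:
  assumes IH: "\<And>a b c' d. SL a b c' d \<Longrightarrow> nn c' < nn c \<Longrightarrow> good a b c' d"
    and SL: "SL a b c d" and q: "q \<in> \<O>" "q' \<in> \<O>" "unit (q' - q)"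
    and less: "cmod (a - q * c) < cmod c" "cmod (a - q' * c) < cmod c"
  shows "u q \<circ> s \<circ> phi (- c) (- d) (a - q * c) (b - q * d)
    = u q' \<circ> s \<circ> phi (- c) (- d) (a - q' * c) (b - q' * d)"
proof -
  define \<eta> r r' r1 r1' where defs: "\<eta> = q' - q" "r = a - q * c" "r' = b - q * d"
    "r1 = a - q' * c" "r1' = b - q' * d"
  have \<eta>: "unit \<eta>" using q by (simp add: defs)
  have [simp]: "\<eta> \<noteq> 0" "\<eta> \<in> \<O>" using \<eta> unit_neq_0 unit_O by auto
  have SLr: "SL r r' c d" using SL_U[OF SL, of "- q"] q by (simp add: defs)
  have r1: "r1 = r - \<eta> * c" "r1' = r' - \<eta> * d" by (simp_all add: defs algebra_simps)
  have SL1: "SL (- c) (- d) r1 r1'"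
    unfolding defs by (rule SL_step) (use SL q in auto)
  have SL2: "SL (- (r / \<eta>)) (- (r' / \<eta>)) r1 r1'"
    using SL_U[OF SL1, of "- (1 / \<eta>)"] unit_O[OF unit_inverse[OF \<eta>]]
    by (simp add: r1 diff_divide_distrib)
  have SL3: "SL r1 r1' (r / \<eta>) (r' / \<eta>)"
    using SL_S[OF SL2] by simp
  have SL4: "SL (r1 / \<eta>) (r1' / \<eta>) r r'"
    using SL_D[OF SL3 unit_inverse[OF \<eta>]] by simp
  have nn: "nn r < nn c" "nn r1 < nn c"
    using SL SL1 SLr less by (auto intro!: nn_less simp: SL_def defs)
  have nn': "nn (r / \<eta>) < nn c" "nn (- (r / \<eta>)) < nn c"
    using nn nn_cong[OF unit_cmod_divide[OF \<eta>]] by (metis, metis nn_cong norm_minus_cancel)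
  have "phi (- c) (- d) r r' = s \<circ> u \<eta> \<circ> s \<circ> phi (- c) (- d) r1 r1'"
  proof (rule good_twist[OF SLr \<eta> r1])
    show "phi r1 r1' (r / \<eta>) (r' / \<eta>) = s \<circ> phi (- (r / \<eta>)) (- (r' / \<eta>)) r1 r1'"
      using good_S[OF IH SL2 nn'(2) nn(2)] by simp
  qed (use IH SL1 SL3 SL4 nn nn' in blast)+
  moreover have "u q' = u q \<circ> u \<eta>"
    using u_add[OF q(1), of \<eta>] q by (simp add: defs)
  ultimately show ?thesis
    unfolding defs[symmetric] by (simp add: s_comp_s comp_assoc)
qed

text \<open>Induction on the norm of \<open>c\<close>. Independence of the quotient comes first, by
  chaining \<open>step_unit\<close> along \<open>quotient_lens\<close>; the other two clauses follow
  by choosing the quotient suited to U(x) A or D(\<epsilon>) A.\<close>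

lemma good: "SL a b c d \<Longrightarrow> good a b c d"
proof (induction "nn c" arbitrary: a b c d rule: less_induct)
  case less
  note SL = less.prems
  have IH: "good a' b' c' d'" if "SL a' b' c' d'" "nn c' < nn c" for a' b' c' d'
    using less.hyps that by blast
  \<comment> \<open>Stated for every matrix whose lower left entry has the norm of \<open>c\<close>,
    because it is also applied to U(x) A and to D(\<epsilon>) A, where \<open>c\<close> becomes
    \<open>c / \<epsilon>\<close>.\<close>
  have step: "phi a b c' d = u q \<circ> s \<circ> phi (- c') (- d) (a - q * c') (b - q * d)"
    if SL: "SL a b c' d" and nn: "nn c' = nn c"
      and q: "q \<in> \<O>" "cmod (a - q * c') < cmod c'" for a b c' d q
  proof -
    have O: "a \<in> \<O>" "c' \<in> \<O>" "c' \<noteq> 0" using SL q by (auto simp: SL_def)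
    let ?F = "\<lambda>q. u q \<circ> s \<circ> phi (- c') (- d) (a - q * c') (b - q * d)"
    let ?p = "quotient a c'"
    have p: "?p \<in> \<O>" "cmod (a - ?p * c') < cmod c'" using quotient[OF O] by auto
    have F: "?F q = ?F q'" if "q \<in> \<O>" "q' \<in> \<O>" "unit (q' - q)"
      "cmod (a - q * c') < cmod c'" "cmod (a - q' * c') < cmod c'" for q q'
      by (rule step_unit[OF _ SL that]) (use IH nn in auto)
    have "?F ?p = ?F q"
      using quotient_lens[OF p(1) q(1) O(3) p(2) less_imp_le[OF q(2)]] F p q by metis
    moreover have "phi a b c' d = ?F ?p"
      using SL O(3) by (subst phi.simps) simp
    ultimately show ?thesis by simp
  qed
  show ?case
    unfolding good_def
  proof (intro conjI ballI allI impI)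
    fix q assume "q \<in> \<O>" "cmod (a - q * c) < cmod c"
    then show "phi a b c d = u q \<circ> s \<circ> phi (- c) (- d) (a - q * c) (b - q * d)"
      by (rule step[OF SL refl])
  next
    fix x assume x: "x \<in> \<O>"
    show "phi (a + x * c) (b + x * d) c d = u x \<circ> phi a b c d"
    proof (cases "c = 0")
      case True
      then have "SL a b 0 d" "SL a (b + x * d) 0 d" and "a * d = 1" and "a \<in> \<O>" "b \<in> \<O>"
        using SL SL_U[OF SL x] by (auto simp: SL_def)
      moreover from this have "a * (b + x * d) = x + a * b" by (simp add: algebra_simps)
      ultimately show ?thesis using True u_add[OF x, of "a * b"]
        by (simp add: phi_upper comp_assoc)
    next
      case False
      obtain q where q: "q \<in> \<O>" "cmod (a - q * c) < cmod c"
        using euclid False SL unfolding SL_def by blast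
      have "phi (a + x * c) (b + x * d) c d
          = u (x + q) \<circ> s \<circ> phi (- c) (- d) (a + x * c - (x + q) * c) (b + x * d - (x + q) * d)"
        by (rule step) (use SL_U[OF SL x] x q in \<open>auto simp: distrib_right\<close>)
      also have "\<dots> = u (x + q) \<circ> s \<circ> phi (- c) (- d) (a - q * c) (b - q * d)"
        by (simp add: algebra_simps)
      finally show ?thesis using step[OF SL refl q] u_add[OF x q(1)] by (simp add: comp_assoc)
    qed
  next
    fix \<epsilon> assume \<epsilon>: "unit \<epsilon>"
    have [simp]: "\<epsilon> \<noteq> 0" "\<epsilon> \<in> \<O>" using \<epsilon> unit_neq_0 unit_O by auto
    show "phi (\<epsilon> * a) (\<epsilon> * b) (c / \<epsilon>) (d / \<epsilon>) = D \<epsilon> \<circ> phi a b c d"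
    proof (cases "c = 0")
      case True
      then have "SL a b 0 d" "SL (\<epsilon> * a) (\<epsilon> * b) 0 (d / \<epsilon>)" and "a * b \<in> \<O>" and a: "unit a"
        using SL SL_D[OF SL \<epsilon>] unit_if_mult_1[of a d] by (auto simp: SL_def)
      then show ?thesis
        using True D_mult[OF \<epsilon> a] D_u[OF \<epsilon>, of "a * b"]
        by (simp add: phi_upper ac_simps flip: comp_assoc)
    next
      case False
      obtain q where q: "q \<in> \<O>" "cmod (a - q * c) < cmod c"
        using euclid False SL unfolding SL_def by blast
      \<comment> \<open>Since D(\<epsilon>) U(q) S = U(\<epsilon>\<epsilon>q) S D(1/\<epsilon>),
        this quotient for D(\<epsilon>) A leaves the old remainder times \<epsilon>.\<close>
      let ?q = "\<epsilon> * \<epsilon> * q"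
      let ?r = "a - q * c" and ?r' = "b - q * d"
      have r: "\<epsilon> * a - ?q * (c / \<epsilon>) = \<epsilon> * ?r" "\<epsilon> * b - ?q * (d / \<epsilon>) = \<epsilon> * ?r'"
        by (simp_all add: field_simps)
      have q': "?q \<in> \<O>" using q by simp
      have SL': "SL (- c) (- d) ?r ?r'" by (rule SL_step[OF SL q(1)])
      have "nn ?r < nn c"
        using SL SL' q by (intro nn_less) (auto simp: SL_def)
      then have D: "phi (1 / \<epsilon> * - c) (1 / \<epsilon> * - d) (?r / (1 / \<epsilon>)) (?r' / (1 / \<epsilon>))
          = D (1 / \<epsilon>) \<circ> phi (- c) (- d) ?r ?r'"
        by (intro good_D IH SL' unit_inverse \<epsilon>)
      have "phi (\<epsilon> * a) (\<epsilon> * b) (c / \<epsilon>) (d / \<epsilon>) = u ?q \<circ> s \<circ> phi (- (c / \<epsilon>)) (- (d / \<epsilon>))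
          (\<epsilon> * a - ?q * (c / \<epsilon>)) (\<epsilon> * b - ?q * (d / \<epsilon>))"
        by (rule step[OF SL_D[OF SL \<epsilon>] _ q'])
          (use q in \<open>simp_all only: r unit_cmod_mult[OF \<epsilon>] unit_cmod_divide[OF \<epsilon>] nn_def\<close>)
      also have "\<dots> = u ?q \<circ> s \<circ> (D (1 / \<epsilon>) \<circ> phi (- c) (- d) ?r ?r')"
        unfolding r D[symmetric] by (simp add: mult.commute)
      also have "\<dots> = u ?q \<circ> (s \<circ> D (1 / \<epsilon>)) \<circ> phi (- c) (- d) ?r ?r'"
        by (simp add: comp_assoc)
      also have "s \<circ> D (1 / \<epsilon>) = D \<epsilon> \<circ> s"
        using s_D[OF unit_inverse[OF \<epsilon>]] by simp
      also have "u ?q \<circ> (D \<epsilon> \<circ> s) = D \<epsilon> \<circ> u q \<circ> s"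
        using D_u[OF \<epsilon> q(1)] by (simp add: comp_assoc)
      finally show ?thesis using step[OF SL refl q] by (simp add: fun_eq_iff)
    qed
  qed
qed

end

section \<open>Matrices\<close>

abbreviation mat2 :: "complex \<Rightarrow> complex \<Rightarrow> complex \<Rightarrow> complex \<Rightarrow> complex^2^2" where
  "mat2 a b c d \<equiv> vector [vector [a, b], vector [c, d]]"

lemma mat2_mult:
  "mat2 a b c d ** mat2 a' b' c' d' =
     mat2 (a * a' + b * c') (a * b' + b * d') (c * a' + d * c') (c * b' + d * d')"
  by (simp add: vec_eq_iff forall_2 matrix_matrix_mult_def sum_2)

lemma mat2_one: "mat 1 = mat2 1 0 0 1"
  by (simp add: vec_eq_iff forall_2 mat_def)

lemma mat2_uminus: "- mat2 a b c d = mat2 (- a) (- b) (- c) (- d)"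
  by (simp add: vec_eq_iff forall_2)

lemma mat2_eta: "mat2 (A $ 1 $ 1) (A $ 1 $ 2) (A $ 2 $ 1) (A $ 2 $ 2) = A"
  by (simp add: vec_eq_iff forall_2)

lemma mat2_eq_iff: "mat2 a b c d = mat2 a' b' c' d' \<longleftrightarrow> a = a' \<and> b = b' \<and> c = c' \<and> d = d'"
  by (auto simp: vec_eq_iff forall_2)

context euclidean_quadratic
begin

section \<open>Identification of the lattice with the ring of integers\<close>

abbreviation disc :: int where "disc \<equiv> - 1 - 2 * t"

lemma csqrt_disc: "csqrt (of_int disc) = (1 + of_int t) * \<zeta> - of_int t"
proof (rule csqrt_unique)
  show "((1 + of_int t) * \<zeta> - of_int t)\<^sup>2 = of_int disc"
  proof -
    have "((1 + of_int t) * \<zeta> - of_int t)\<^sup>2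
        = (1 + of_int t)\<^sup>2 * (\<zeta> * \<zeta>) - 2 * of_int t * (1 + of_int t) * \<zeta> + (of_int t)\<^sup>2"
      by (simp add: power2_eq_square algebra_simps)
    then show ?thesis using t_cases by (auto simp: zeta_square)
  qed
  show "0 < Re ((1 + of_int t) * \<zeta> - of_int t) \<or>
      Re ((1 + of_int t) * \<zeta> - of_int t) = 0 \<and> 0 \<le> Im ((1 + of_int t) * \<zeta> - of_int t)"
    using t_cases Re_zeta Im_zeta_pos by auto
qed

lemma quadratic_field_eq: "quadratic_field disc = {a + b * \<zeta> | a b. a \<in> \<rat> \<and> b \<in> \<rat>}"
proof -
  have "\<exists>a' b'. a + b * csqrt (of_int disc) = a' + b' * \<zeta> \<and> a' \<in> \<rat> \<and> b' \<in> \<rat>"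
    if "a \<in> \<rat>" "b \<in> \<rat>" for a b
    unfolding csqrt_disc
    by (rule exI[of _ "a - b * of_int t"], rule exI[of _ "b * (1 + of_int t)"])
      (use that in \<open>auto simp: algebra_simps\<close>)
  moreover have "\<exists>a' b'. a + b * \<zeta> = a' + b' * csqrt (of_int disc) \<and> a' \<in> \<rat> \<and> b' \<in> \<rat>"
    if "a \<in> \<rat>" "b \<in> \<rat>" for a b
  proof (rule exI[of _ "a + b / (1 + of_int t) * of_int t"], rule exI[of _ "b / (1 + of_int t)"])
    have "(1 + of_int t :: complex) \<noteq> 0" using t_cases by auto
    then show "a + b * \<zeta> = a + b / (1 + of_int t) * of_int t
        + b / (1 + of_int t) * csqrt (of_int disc) \<and>
      a + b / (1 + of_int t) * of_int t \<in> \<rat> \<and> b / (1 + of_int t) \<in> \<rat>"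
      unfolding csqrt_disc using that t_cases by (elim disjE) (auto simp: field_simps)
  qed
  ultimately show ?thesis unfolding quadratic_field_def by blast
qed

text \<open>A common denominator \<open>\<beta>\<close> of all powers of \<open>x\<close> that has minimal norm can be replaced
  by \<open>\<beta> (x - q)\<close> with \<open>q\<close> a lattice point at distance less than 1 from \<open>x\<close>, hence \<open>x = q\<close>.\<close>

lemma integrally_closed:
  assumes "\<beta> \<in> \<O>" "\<beta> \<noteq> 0" "\<And>k. \<beta> * x ^ k \<in> \<O>"
  shows "x \<in> \<O>"
  using assms
proof (induction "nn \<beta>" arbitrary: \<beta> rule: less_induct)
  case less
  obtain q where q: "q \<in> \<O>" "cmod (x - q) < 1" using covering by blast
  let ?\<beta> = "\<beta> * (x - q)"
  have \<beta>: "?\<beta> * x ^ k \<in> \<O>" for k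
  proof -
    have "?\<beta> * x ^ k = \<beta> * x ^ Suc k - q * (\<beta> * x ^ k)" by (simp add: algebra_simps)
    then show ?thesis using less.prems(3) q(1) by (metis O_diff O_mult)
  qed
  show ?case
  proof (cases "?\<beta> = 0")
    case True
    then show ?thesis using less.prems q by simp
  next
    case False
    have "cmod ?\<beta> < cmod \<beta>" using q less.prems by (simp add: norm_mult)
    then show ?thesis
      using less.hyps[OF nn_less _ False] \<beta>[of 0] \<beta> less.prems by simp
  qed
qed

lemma common_denominator:
  assumes "x \<in> quadratic_field disc"
  obtains M :: int where "M > 0" "of_int M * x \<in> \<O>"
proof -
  obtain a b where ab: "x = a + b * \<zeta>" "a \<in> \<rat>" "b \<in> \<rat>"
    using assms unfolding quadratic_field_eq by blast
  obtain p q where pq: "a = of_int p / of_int q" "q > 0"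
    using Rats_cases'[OF ab(2)] by metis
  obtain p' q' where pq': "b = of_int p' / of_int q'" "q' > 0"
    using Rats_cases'[OF ab(3)] by metis
  have "of_int (q * q') * x = of_int (p * q') + of_int (p' * q) * \<zeta>"
    using pq pq' by (simp add: ab(1) field_simps)
  then show thesis using that[of "q * q'"] in_O pq pq' by simp
qed

text \<open>If M x lies in \<open>\<O>\<close> and x is a root of a monic integral polynomial of
  degree n, then \<open>M ^ n\<close> is a common denominator of all powers of x: directly up to
  exponent n, and by the equation beyond. Hence \<open>integrally_closed\<close> applies.\<close>

lemma algebraic_int_O:
  assumes "x \<in> quadratic_field disc" "algebraic_int x"
  shows "x \<in> \<O>"
proof -
  obtain M where M: "M > 0" "of_int M * x \<in> \<O>" using common_denominator assms(1) by blast
  obtain p where p: "lead_coeff p = 1" "\<And>i. coeff p i \<in> \<int>" "poly p x = 0"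
    using assms(2) by (auto elim: algebraic_int.cases)
  define n where "n = degree p"
  let ?N = "of_int (M ^ n)"
  have pow: "of_int M ^ k * x ^ k \<in> \<O>" for k
  proof -
    have "(of_int M * x) ^ k \<in> \<O>" using M(2) by (induction k) simp_all
    then show ?thesis by (simp add: power_mult_distrib)
  qed
  have "?N * x ^ k \<in> \<O>" for k
  proof (induction k rule: less_induct)
    case (less k)
    show ?case
    proof (cases "k \<le> n")
      case True
      then have "?N * x ^ k = of_int (M ^ (n - k)) * (of_int M ^ k * x ^ k)"
        by (simp flip: power_add)
      then show ?thesis using pow by (metis O_mult of_int_O)
    next
      case False
      have "x ^ n = - (\<Sum>i<n. coeff p i * x ^ i)"
        using p unfolding poly_altdef n_def by (simp add: lessThan_Suc_atMost[symmetric] add_eq_0_iff2)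
      then have "?N * x ^ k = - ?N * x ^ (k - n) * (\<Sum>i<n. coeff p i * x ^ i)"
        using False by (metis le_add_diff_inverse2 mult.assoc mult_minus_left mult_minus_right nat_le_linear power_add)
      also have "\<dots> = - (\<Sum>i<n. coeff p i * (?N * x ^ (k - n + i)))"
        by (simp add: sum_distrib_left power_add ac_simps sum_negf)
      also have "\<dots> \<in> \<O>"
      proof (intro O_uminus)
        have "(\<Sum>i\<in>I. coeff p i * (?N * x ^ (k - n + i))) \<in> \<O>" if "finite I" "I \<subseteq> {..<n}" for I
          using that
        proof (induction I rule: finite_induct)
          case (insert i I)
          have "coeff p i \<in> \<O>" using p(2)[of i] by (auto elim: Ints_cases)
          then show ?case using insert less.IH[of "k - n + i"] False by auto
        qed simp
        then show "(\<Sum>i<n. coeff p i * (?N * x ^ (k - n + i))) \<in> \<O>" by blast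
      qed
      finally show ?thesis .
    qed
  qed
  then show ?thesis using integrally_closed[OF of_int_O, of "M ^ n" x] M(1) by simp
qed

lemma ring_of_integers_eq: "ring_of_integers disc = \<O>"
proof -
  have "x \<in> ring_of_integers disc" if xO: "x \<in> \<O>" for x
  proof -
    obtain m n where x: "x = of_int m + of_int n * \<zeta>" using xO by (rule O_cases)
    then have "x \<in> quadratic_field disc"
      unfolding quadratic_field_eq using Rats_of_int by blast
    moreover have "algebraic_int x"
    proof (rule algebraic_int.intros)
      \<comment> \<open>The characteristic polynomial of x, with trace \<open>2 * m + t * n\<close>
        and the norm from \<open>cmod_O\<close>.\<close>
      let ?p = "[:of_int (m\<^sup>2 + t * m * n + n\<^sup>2), - of_int (2 * m + t * n), 1:] :: complex poly"
      show "lead_coeff ?p = 1" by simp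
      show "\<forall>i. coeff ?p i \<in> \<int>" by (auto simp: coeff_pCons split: nat.splits)
      have "poly ?p x = of_int n * of_int n * (\<zeta> * \<zeta> - of_int t * \<zeta> + 1)"
        by (simp add: x power2_eq_square algebra_simps)
      then show "poly ?p x = 0" by (simp add: zeta_square)
    qed
    ultimately show ?thesis by (simp add: ring_of_integers_def)
  qed
  then show ?thesis using algebraic_int_O by (auto simp: ring_of_integers_def)
qed

section \<open>Generation of the special linear group\<close>

lemma mat2_SL2: "mat2 a b c d \<in> carrier (SL2 disc) \<longleftrightarrow> SL a b c d"
  by (auto simp: SL2_def SL_def forall_2 det_2 ring_of_integers_eq)

lemma SL2_cases:
  assumes "A \<in> carrier (SL2 disc)"
  obtains a b c d where "A = mat2 a b c d" "SL a b c d"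
  using assms mat2_eta[of A] mat2_SL2 by metis

lemma SL_mult:
  "SL a b c d \<Longrightarrow> SL a' b' c' d' \<Longrightarrow>
     SL (a * a' + b * c') (a * b' + b * d') (c * a' + d * c') (c * b' + d * d')"
proof -
  assume *: "SL a b c d" "SL a' b' c' d'"
  have "(a * a' + b * c') * (c * b' + d * d') - (a * b' + b * d') * (c * a' + d * c')
      = (a * d - b * c) * (a' * d' - b' * c')" by (simp add: algebra_simps)
  then show ?thesis using * by (auto simp: SL_def)
qed

lemma SL2_mult [simp]: "A \<otimes>\<^bsub>SL2 d\<^esub> B = A ** B" and SL2_one [simp]: "\<one>\<^bsub>SL2 d\<^esub> = mat 1"
  by (simp_all add: SL2_def)

lemma SL2_closed: "A \<in> carrier (SL2 disc) \<Longrightarrow> B \<in> carrier (SL2 disc) \<Longrightarrow> A ** B \<in> carrier (SL2 disc)"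
  by (elim SL2_cases) (simp add: mat2_mult mat2_SL2 SL_mult)

lemma SL2_inverse:
  assumes "SL a b c d"
  shows "mat2 d (- b) (- c) a ** mat2 a b c d = mat 1" "SL d (- b) (- c) a"
  using assms by (auto simp: mat2_mult mat2_one SL_def algebra_simps)

lemma group_SL2: "group (SL2 disc)"
proof (rule groupI)
  show "\<one>\<^bsub>SL2 disc\<^esub> \<in> carrier (SL2 disc)" by (simp add: mat2_one mat2_SL2 SL_def)
  fix A assume A: "A \<in> carrier (SL2 disc)"
  then obtain a b c d where *: "A = mat2 a b c d" "SL a b c d" by (rule SL2_cases)
  then show "\<exists>B\<in>carrier (SL2 disc). B \<otimes>\<^bsub>SL2 disc\<^esub> A = \<one>\<^bsub>SL2 disc\<^esub>"
    using SL2_inverse mat2_SL2 by fastforce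
qed (auto simp: SL2_closed matrix_mul_assoc)

lemma inv_SL2: "SL a b c d \<Longrightarrow> inv\<^bsub>SL2 disc\<^esub> (mat2 a b c d) = mat2 d (- b) (- c) a"
  using SL2_inverse mat2_SL2 by (intro group.inv_equality[OF group_SL2]) simp_all

text \<open>The Euclidean algorithm as an induction rule. It serves for the generation by elementary
  matrices and for extending statements on generators to all matrices, as in
  \<open>Phi_mult\<close>.\<close>

lemma SL2_induct [consumes 1, case_names upper step]:
  assumes "A \<in> carrier (SL2 disc)"
    and upper: "\<And>x \<epsilon>. x \<in> \<O> \<Longrightarrow> unit \<epsilon> \<Longrightarrow> P (mat2 1 x 0 1 ** mat2 \<epsilon> 0 0 (1 / \<epsilon>))"
    and step: "\<And>q A. q \<in> \<O> \<Longrightarrow> A \<in> carrier (SL2 disc) \<Longrightarrow> P A \<Longrightarrow>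
      P (mat2 1 q 0 1 ** (mat2 0 1 (- 1) 0 ** A))"
  shows "P A"
proof -
  have "P (mat2 a b c d)" if "SL a b c d" for a b c d
    using that
  proof (induction "nn c" arbitrary: a b c d rule: less_induct)
    case less
    then have O: "a \<in> \<O>" "b \<in> \<O>" "c \<in> \<O>" "d \<in> \<O>" "a * d - b * c = 1" by (auto simp: SL_def)
    show ?case
    proof (cases "c = 0")
      case True
      then have a: "unit a" using unit_if_mult_1[of a d] O by simp
      moreover have "mat2 a b c d = mat2 1 (a * b) 0 1 ** mat2 a 0 0 (1 / a)"
        using True O unit_neq_0[OF a] by (simp add: mat2_mult mat2_eq_iff field_simps)
      ultimately show ?thesis using upper[of "a * b" a] O by simp
    next
      case False
      obtain q where q: "q \<in> \<O>" "cmod (a - q * c) < cmod c"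
        using euclid O False by blast
      let ?A = "mat2 (- c) (- d) (a - q * c) (b - q * d)"
      have SL: "SL (- c) (- d) (a - q * c) (b - q * d)" by (rule SL_step[OF less.prems q(1)])
      have "P ?A"
        by (rule less.hyps[OF nn_less SL]) (use SL O q in \<open>auto simp: SL_def\<close>)
      moreover have "mat2 a b c d = mat2 1 q 0 1 ** (mat2 0 1 (- 1) 0 ** ?A)"
        by (simp add: mat2_mult)
      ultimately show ?thesis using step[OF q(1), of ?A] SL mat2_SL2 by simp
    qed
  qed
  then show ?thesis using assms(1) by (elim SL2_cases) simp
qed

text \<open>By \<open>SL2_induct\<close> it suffices to obtain S, all U(x) and all D(\<epsilon>).
  The U(x) come additively from the integral basis, and D(\<epsilon>) is the word U(\<epsilon>) S
  U(1/\<epsilon>) S U(\<epsilon>) S.\<close>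

lemma E2_eq_SL2:
  assumes w: "integral_basis disc w"
  shows "E2 disc w = carrier (SL2 disc)"
proof
  interpret G: group "SL2 disc" by (rule group_SL2)
  let ?G = "{mat2 1 1 0 1, mat2 1 w 0 1, mat2 0 1 (- 1) 0}"
  let ?E = "E2 disc w"
  have wO: "w \<in> \<O>" using w by (simp add: integral_basis_def ring_of_integers_eq)
  have gens: "?G \<subseteq> carrier (SL2 disc)"
    using wO by (simp add: mat2_SL2 SL_def)
  have "subgroup ?E (SL2 disc)"
    unfolding E2_def by (rule G.generate_is_subgroup[OF gens])
  then interpret E: subgroup ?E "SL2 disc" .
  show "?E \<subseteq> carrier (SL2 disc)" by (rule E.subset)
  have "?G \<subseteq> ?E" unfolding E2_def by (auto intro: generate.incl)
  then have E: "mat2 1 1 0 1 \<in> ?E" "mat2 1 w 0 1 \<in> ?E" "mat2 0 1 (- 1) 0 \<in> ?E" by auto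
  have mult: "A ** B \<in> ?E" if "A \<in> ?E" "B \<in> ?E" for A B
    using E.m_closed[OF that] by simp
  have uminus: "mat2 1 (- x) 0 1 \<in> ?E" if "mat2 1 x 0 1 \<in> ?E" for x
    using E.m_inv_closed[OF that] inv_SL2[of 1 x 0 1] E.mem_carrier[OF that] by (simp add: mat2_SL2)
  have add: "mat2 1 (x + y) 0 1 \<in> ?E" if "mat2 1 x 0 1 \<in> ?E" "mat2 1 y 0 1 \<in> ?E" for x y
    using mult[OF that] by (simp add: mat2_mult add.commute)
  have of_int: "mat2 1 (of_int m * x) 0 1 \<in> ?E" if x: "mat2 1 x 0 1 \<in> ?E" for m x
  proof (induction m rule: int_induct[where k = 0])
    case base
    then show ?case using E.one_closed by (simp add: mat2_one)
  next
    case (step1 i)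
    then show ?case using add[OF step1(2) x] by (simp add: algebra_simps)
  next
    case (step2 i)
    then show ?case using add[OF step2(2) uminus[OF x]] by (simp add: algebra_simps)
  qed
  have U: "mat2 1 x 0 1 \<in> ?E" if x: "x \<in> \<O>" for x
  proof -
    have "\<exists>!(m, n). x = of_int m * 1 + of_int n * w"
      using w x unfolding integral_basis_def ring_of_integers_eq by blast
    then obtain p :: "int \<times> int" where "case p of (m, n) \<Rightarrow> x = of_int m * 1 + of_int n * w"
      by blast
    then obtain m n where "x = of_int m * 1 + of_int n * w"
      by (cases p) auto
    then show ?thesis using add[OF of_int[OF E(1), of m] of_int[OF E(2), of n]] by simp
  qed
  have uminus': "- A \<in> ?E" if "A \<in> ?E" for A
  proof -
    have "mat2 0 1 (- 1) 0 ** (mat2 0 1 (- 1) 0 ** A) \<in> ?E" using E mult that by blast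
    moreover have "mat2 0 1 (- 1) 0 ** (mat2 0 1 (- 1) 0 ** A) = - A"
      by (subst (1 2) mat2_eta[of A, symmetric]) (simp add: mat2_mult mat2_uminus)
    ultimately show ?thesis by simp
  qed
  have D: "mat2 \<epsilon> 0 0 (1 / \<epsilon>) \<in> ?E" if \<epsilon>: "unit \<epsilon>" for \<epsilon>
  proof -
    let ?S = "mat2 0 1 (- 1) 0"
    have "mat2 1 \<epsilon> 0 1 ** (?S ** (mat2 1 (1 / \<epsilon>) 0 1 ** (?S ** (mat2 1 \<epsilon> 0 1 ** ?S)))) \<in> ?E"
      by (intro mult U E unit_O unit_inverse \<epsilon>)
    moreover have "mat2 1 \<epsilon> 0 1 ** (?S ** (mat2 1 (1 / \<epsilon>) 0 1 ** (?S ** (mat2 1 \<epsilon> 0 1 ** ?S))))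
        = mat2 \<epsilon> 0 0 (1 / \<epsilon>)"
      using unit_neq_0[OF \<epsilon>] by (simp add: mat2_mult mat2_eq_iff)
    ultimately show ?thesis by simp
  qed
  show "carrier (SL2 disc) \<subseteq> ?E"
  proof
    fix A assume "A \<in> carrier (SL2 disc)"
    then show "A \<in> ?E"
      by (induction A rule: SL2_induct) (intro mult U D E; assumption)+
  qed
qed

lemma PSL2_eq_PE2: "integral_basis disc w \<Longrightarrow> PSL2 disc = PE2 disc w"
  by (simp add: PSL2_def PE2_def E2_eq_SL2)

end

section \<open>A criterion for non-congruence kernels\<close>

text \<open>Write \<open>p * q * n = p ^ k * m\<close> with \<open>m\<close> prime to
  \<open>p\<close>. By Bezout there is a multiple \<open>e\<close> of \<open>m\<close> that is 1
  modulo \<open>p ^ k\<close>, and \<open>e * (1 - e)\<close> is divisible by the whole product.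
  Including the factors \<open>p\<close> and \<open>q\<close> ensures \<open>k > 0\<close> and
  \<open>q dvd m\<close>.\<close>

lemma coprime_idempotent:
  fixes p q n :: int
  assumes p: "prime p" and "\<not> p dvd q" "q \<noteq> 0" "n \<noteq> 0"
  obtains e where "p dvd e - 1" "q dvd e" "n dvd e * (1 - e)"
proof -
  have "p * q * n \<noteq> 0" using assms by auto
  then obtain m where m: "p * q * n = p ^ multiplicity p (p * q * n) * m" "\<not> p dvd m"
    using multiplicity_decompose'[of "p * q * n" p] p not_prime_unit by metis
  define k where "k = multiplicity p (p * q * n)"
  have "coprime p m" "coprime p q"
    using m(2) assms(2) p prime_imp_coprime by blast+
  then have "coprime (p ^ k) m" "coprime q (p ^ k)"
    by (simp_all add: coprime_commute)
  then obtain a b where ab: "a * p ^ k + b * m = 1"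
    by (metis bezout_int coprime_imp_gcd_eq_1)
  have pk: "p * q * n = p ^ k * m" using m(1) unfolding k_def .
  have "p dvd p ^ k"
  proof (cases k)
    case 0
    then have "m = p * (q * n)" using pk by simp
    then show ?thesis using m(2) by simp
  qed simp
  have "q dvd p ^ k * m" unfolding pk[symmetric] by simp
  then have "q dvd m" using \<open>coprime q (p ^ k)\<close> coprime_dvd_mult_right_iff by blast
  show thesis
  proof
    have "b * m - 1 = - a * p ^ k" using ab by simp
    then show "p dvd b * m - 1" using \<open>p dvd p ^ k\<close> by simp
    show "q dvd b * m" using \<open>q dvd m\<close> by simp
    have "1 - b * m = a * p ^ k" using ab by simp
    then have "b * m * (1 - b * m) = a * b * (p ^ k * m)" by simp
    also have "\<dots> = a * b * (p * q * n)" by (simp only: pk)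
    finally have "b * m * (1 - b * m) = n * (a * b * p * q)" by (simp add: ac_simps)
    then show "n dvd b * m * (1 - b * m)" by (metis dvd_triv_left)
  qed
qed

context euclidean_quadratic
begin

lemma normal_pm_I: "pm_I \<lhd> SL2 disc"
proof -
  interpret G: group "SL2 disc" by (rule group_SL2)
  have m1: "- mat 1 \<in> carrier (SL2 disc)" "mat 1 \<in> carrier (SL2 disc)"
    by (simp_all add: mat2_one mat2_uminus mat2_SL2 SL_def)
  have mm: "- mat 1 ** A = - A" "A ** - mat 1 = - A" for A :: "complex^2^2"
    by (subst (1 2) mat2_eta[of A, symmetric], simp add: mat2_one mat2_uminus mat2_mult)+
  have inv: "inv\<^bsub>SL2 disc\<^esub> (- mat 1) = - mat 1"
    using m1 mm by (intro G.inv_equality) auto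
  have "subgroup pm_I (SL2 disc)"
    by (rule G.subgroupI) (use m1 mm inv G.inv_one in \<open>auto simp: pm_I_def\<close>)
  then show ?thesis
    unfolding G.normal_inv_iff
  proof (intro conjI ballI)
    fix A B assume A: "A \<in> carrier (SL2 disc)" and B: "B \<in> pm_I"
    have "A ** inv\<^bsub>SL2 disc\<^esub> A = mat 1" using G.r_inv[OF A] by simp
    moreover have "A ** - mat 1 ** C = - (A ** C)" for C :: "complex^2^2"
      using mm[of "A ** C"] mm[of A] by (metis matrix_mul_assoc)
    ultimately show "A \<otimes>\<^bsub>SL2 disc\<^esub> B \<otimes>\<^bsub>SL2 disc\<^esub> inv\<^bsub>SL2 disc\<^esub> A \<in> pm_I"
      using B by (auto simp: pm_I_def)
  qed
qed

lemma group_PSL2: "group (PSL2 disc)"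
  unfolding PSL2_def by (rule normal.factorgroup_is_group[OF normal_pm_I])

end

context sl2_relations
begin

section \<open>The homomorphism on matrices and its kernel\<close>

definition Phi :: "complex^2^2 \<Rightarrow> 'a \<Rightarrow> 'a" where
  "Phi A = phi (A $ 1 $ 1) (A $ 1 $ 2) (A $ 2 $ 1) (A $ 2 $ 2)"

lemma Phi_mat2: "Phi (mat2 a b c d) = phi a b c d"
  by (simp add: Phi_def)

lemma Phi_one: "Phi (mat 1) = id"
  by (simp add: mat2_one Phi_mat2 phi_upper SL_def)

lemma Phi_U_mult:
  assumes "x \<in> \<O>" "A \<in> carrier (SL2 disc)"
  shows "Phi (mat2 1 x 0 1 ** A) = u x \<circ> Phi A"
  using assms good_U[OF good] by (elim SL2_cases) (simp add: mat2_mult Phi_mat2)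

lemma Phi_D_mult:
  assumes "unit \<epsilon>" "A \<in> carrier (SL2 disc)"
  shows "Phi (mat2 \<epsilon> 0 0 (1 / \<epsilon>) ** A) = D \<epsilon> \<circ> Phi A"
  using assms good_D[OF good] by (elim SL2_cases) (simp add: mat2_mult Phi_mat2)

lemma Phi_S_mult:
  assumes "A \<in> carrier (SL2 disc)"
  shows "Phi (mat2 0 1 (- 1) 0 ** A) = s \<circ> Phi A"
proof -
  obtain a b c d where A: "A = mat2 a b c d" "SL a b c d" using assms by (rule SL2_cases)
  have "phi c d (- a) (- b) = s \<circ> phi a b c d"
    by (rule good_S[of "Suc (nn a + nn c)"]) (use good A in auto)
  then show ?thesis by (simp add: A mat2_mult Phi_mat2)
qed

lemma U_SL2: "x \<in> \<O> \<Longrightarrow> mat2 1 x 0 1 \<in> carrier (SL2 disc)"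
  and S_SL2: "mat2 0 1 (- 1) 0 \<in> carrier (SL2 disc)"
  and D_SL2: "unit \<epsilon> \<Longrightarrow> mat2 \<epsilon> 0 0 (1 / \<epsilon>) \<in> carrier (SL2 disc)"
  by (simp_all add: mat2_SL2 SL_def unit_O unit_inverse unit_neq_0)

lemma one_SL2: "mat 1 \<in> carrier (SL2 disc)"
  by (simp add: mat2_one mat2_SL2 SL_def)

lemma Phi_U: "x \<in> \<O> \<Longrightarrow> Phi (mat2 1 x 0 1) = u x"
  and Phi_S: "Phi (mat2 0 1 (- 1) 0) = s"
  and Phi_D: "unit \<epsilon> \<Longrightarrow> Phi (mat2 \<epsilon> 0 0 (1 / \<epsilon>)) = D \<epsilon>"
  using Phi_U_mult[of x "mat 1"] Phi_S_mult[of "mat 1"] Phi_D_mult[of \<epsilon> "mat 1"] one_SL2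
  by (simp_all add: Phi_one)

lemma Phi_mult:
  assumes "A \<in> carrier (SL2 disc)" and B: "B \<in> carrier (SL2 disc)"
  shows "Phi (A ** B) = Phi A \<circ> Phi B"
  using assms(1)
proof (induction A rule: SL2_induct)
  case (upper x \<epsilon>)
  then show ?case
    using Phi_U_mult Phi_D_mult Phi_U Phi_D B D_SL2 SL2_closed
    by (simp add: comp_assoc flip: matrix_mul_assoc)
next
  case (step q A)
  then show ?case
    using Phi_U_mult Phi_S_mult B S_SL2 SL2_closed
    by (simp add: comp_assoc flip: matrix_mul_assoc)
qed

lemma Phi_uminus: "A \<in> carrier (SL2 disc) \<Longrightarrow> Phi (- A) = Phi A"
  using good_uminus[OF good] by (elim SL2_cases) (simp add: mat2_uminus Phi_mat2)

text \<open>With the image as target no group of permutations has to be fixed; inverses are the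
  images of inverse matrices.\<close>

definition image_group :: "('a \<Rightarrow> 'a) monoid" where
  "image_group = \<lparr>carrier = Phi ` carrier (SL2 disc), monoid.mult = (\<circ>), one = id\<rparr>"

lemma group_image: "group image_group"
proof (rule groupI)
  fix f assume "f \<in> carrier image_group"
  then obtain A where A: "A \<in> carrier (SL2 disc)" "f = Phi A" by (auto simp: image_group_def)
  interpret G: group "SL2 disc" by (rule group_SL2)
  have "Phi (inv\<^bsub>SL2 disc\<^esub> A) \<circ> f = id"
    using Phi_mult[of "inv\<^bsub>SL2 disc\<^esub> A" A] G.l_inv[OF A(1)] A Phi_one by simp
  then show "\<exists>g\<in>carrier image_group. g \<otimes>\<^bsub>image_group\<^esub> f = \<one>\<^bsub>image_group\<^esub>"
    using A by (auto simp: image_group_def)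
next
  show "\<one>\<^bsub>image_group\<^esub> \<in> carrier image_group"
    unfolding image_group_def using Phi_one one_SL2 by (metis image_eqI monoid.simps(2) partial_object.simps(1))
qed (use SL2_closed in \<open>auto simp: image_group_def comp_assoc simp flip: Phi_mult\<close>)

lemma group_hom_Phi: "group_hom (SL2 disc) image_group Phi"
  by (intro group_hom.intro group_hom_axioms.intro group_SL2 group_image)
    (auto simp: hom_def image_group_def Phi_mult)

text \<open>As \<open>Phi\<close> takes the same value at A and -A, it factors through
  \<open>PSL2\<close>. N is the kernel of the induced map, and the quotient by N embeds into the
  finite image.\<close>

lemma normal_finite_index:
  assumes "finite (Phi ` carrier (SL2 disc))"
  obtains N where "N \<lhd> PSL2 disc" "finite (rcosets\<^bsub>PSL2 disc\<^esub> N)"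
    "\<And>A. A \<in> carrier (SL2 disc) \<Longrightarrow> pm_I #>\<^bsub>SL2 disc\<^esub> A \<in> N \<longleftrightarrow> Phi A = id"
proof -
  interpret h: group_hom "SL2 disc" image_group Phi by (rule group_hom_Phi)
  have "pm_I \<subseteq> kernel (SL2 disc) image_group Phi"
    using one_SL2 Phi_one Phi_uminus[OF one_SL2]
      normal_imp_subgroup[OF normal_pm_I] subgroup.subset
    by (fastforce simp: pm_I_def kernel_def image_group_def)
  then obtain g where g: "g \<in> hom (PSL2 disc) image_group"
    "\<And>A. A \<in> carrier (SL2 disc) \<Longrightarrow> g (pm_I #>\<^bsub>SL2 disc\<^esub> A) = Phi A"
    using h.FactGroup_universal_kernel[OF normal_pm_I] unfolding PSL2_def by metis
  interpret g: group_hom "PSL2 disc" image_group g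
    by (intro group_hom.intro group_hom_axioms.intro group_PSL2 group_image g(1))
  let ?N = "kernel (PSL2 disc) image_group g"
  have "(\<lambda>X. the_elem (g ` X)) ` carrier (PSL2 disc Mod ?N) \<subseteq> Phi ` carrier (SL2 disc)"
    using g.FactGroup_the_elem_mem by (auto simp: image_group_def)
  then have "finite (carrier (PSL2 disc Mod ?N))"
    using g.FactGroup_inj_on assms inj_on_finite by blast
  then have "finite (rcosets\<^bsub>PSL2 disc\<^esub> ?N)" by (simp add: FactGroup_def)
  moreover have "pm_I #>\<^bsub>SL2 disc\<^esub> A \<in> ?N \<longleftrightarrow> Phi A = id" if A: "A \<in> carrier (SL2 disc)" for A
    using g(2)[OF A] A by (auto simp: kernel_def image_group_def PSL2_def carrier_FactGroup)
  ultimately show thesis using that g.normal_kernel by blast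
qed

section \<open>No principal congruence subgroup lies in the kernel\<close>

lemma u_of_int_mult_id:
  assumes "x \<in> \<O>" "u x = id"
  shows "u (of_int m * x) = id"
proof (induction m rule: int_induct[where k = 0])
  case base
  then show ?case by simp
next
  case (step1 i)
  then show ?case using assms u_add[of "of_int i * x" x] by (simp add: algebra_simps)
next
  case (step2 i)
  then show ?case using assms u_add[of "of_int (i - 1) * x" x] by (simp add: algebra_simps)
qed

lemma u_cong:
  assumes "x \<in> \<O>" "u (of_int p * x) = id" "p dvd e - 1"
  shows "u (of_int e * x) = u x"
proof -
  obtain k where "e - 1 = p * k" using assms(3) by blast
  then have e: "e = 1 + p * k" by simp
  have "of_int e * x = x + of_int k * (of_int p * x)" by (simp add: e algebra_simps)
  then show ?thesis
    using u_of_int_mult_id[of "of_int p * x" k] assms u_add[of x "of_int k * (of_int p * x)"] by simp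
qed

lemma noncongruence:
  fixes p q :: int
  assumes fin: "finite (Phi ` carrier (SL2 disc))"
    and pq: "prime p" "\<not> p dvd q" "q \<noteq> 0"
    and xy: "x \<in> \<O>" "y \<in> \<O>" "u (of_int p * x) = id" "u (of_int q * y) = id"
    and neq: "u x \<circ> (s \<circ> u y \<circ> s) \<noteq> (s \<circ> u y \<circ> s) \<circ> u x"
  shows "\<exists>N. N \<lhd> PSL2 disc \<and> noncongruence_subgroup disc N"
proof -
  obtain N where N: "N \<lhd> PSL2 disc" "finite (rcosets\<^bsub>PSL2 disc\<^esub> N)"
    "\<And>A. A \<in> carrier (SL2 disc) \<Longrightarrow> pm_I #>\<^bsub>SL2 disc\<^esub> A \<in> N \<longleftrightarrow> Phi A = id"
    using normal_finite_index[OF fin] by metis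
  have False if \<pi>: "ideal \<pi> (OK disc)" "\<pi> \<noteq> {0}" "principal_congruence_subgroup disc \<pi> \<subseteq> N" for \<pi>
  proof -
    interpret \<pi>: ideal \<pi> "OK disc" by (rule \<pi>(1))
    have OK: "carrier (OK disc) = \<O>" "\<zero>\<^bsub>OK disc\<^esub> = 0" "x \<otimes>\<^bsub>OK disc\<^esub> y = x * y" for x y
      by (simp_all add: OK_def ring_of_integers_eq)
    have "0 \<in> \<pi>" using additive_subgroup.zero_closed[OF ideal.axioms(1)[OF \<pi>(1)]] OK(2) by simp
    then obtain \<alpha> where \<alpha>: "\<alpha> \<in> \<pi>" "\<alpha> \<noteq> 0" using \<pi>(2) by blast
    then have "\<alpha> \<in> \<O>" using \<pi>.Icarr OK by auto
    obtain k where k: "(cmod \<alpha>)\<^sup>2 = of_nat k" using cmod_O_nat[OF \<open>\<alpha> \<in> \<O>\<close>] by blast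
    \<comment> \<open>The norm of a nonzero element of the ideal is a nonzero integer in it, so the
      integer \<open>n\<close> can serve as the level.\<close>
    define n where "n = int k"
    have "\<alpha> * cnj \<alpha> = of_int n"
      using k by (simp add: n_def complex_norm_square[symmetric] flip: of_real_power)
    moreover have "\<alpha> * cnj \<alpha> \<in> \<pi>"
      using \<pi>.I_r_closed[OF \<alpha>(1)] O_cnj[OF \<open>\<alpha> \<in> \<O>\<close>] OK by simp
    ultimately have n: "of_int n \<in> \<pi>" by simp
    have "k \<noteq> 0" using k \<alpha>(2) by (metis norm_eq_zero of_nat_0 power_eq_0_iff)
    then have "n \<noteq> 0" by (simp add: n_def)
    obtain e where e: "p dvd e - 1" "q dvd e" "n dvd e * (1 - e)"
      using coprime_idempotent[OF pq \<open>n \<noteq> 0\<close>] by blast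
    \<comment> \<open>The sign makes the lower unipotent matrix with entry \<gamma> equal to
      \<open>S U((1-e)y) S\<^sup>-\<^sup>1\<close>. The product \<beta>\<gamma> is a multiple of
      \<open>e * (1 - e)\<close>, hence of \<open>n\<close>.\<close>
    define \<beta> \<gamma> where "\<beta> = of_int e * x" and "\<gamma> = - (of_int (1 - e) * y)"
    have \<beta>\<gamma>: "\<beta> \<in> \<O>" "\<gamma> \<in> \<O>" using xy by (simp_all add: \<beta>_def \<gamma>_def)
    obtain l where l: "e * (1 - e) = n * l" using e(3) by blast
    have "\<beta> * \<gamma> = - (of_int (e * (1 - e)) * (x * y))" by (simp add: \<beta>_def \<gamma>_def)
    also have "\<dots> = of_int n * (- (of_int l * x * y))" unfolding l by simp
    finally have \<pi>_mult: "\<beta> * \<gamma> * z \<in> \<pi>" if "z \<in> \<O>" for z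
      using \<pi>.I_r_closed[OF n, of "- (of_int l * x * y) * z"] OK xy that by (simp add: mult.assoc)
    let ?S = "mat2 0 1 (- 1) 0"
    let ?U = "mat2 1 \<beta> 0 1" and ?L = "mat2 1 0 \<gamma> 1"
    \<comment> \<open>The commutator of \<open>?U\<close> and \<open>?L\<close>. Every entry of its
      difference from the identity is a multiple of \<beta>\<gamma>.\<close>
    let ?C = "mat2 (1 + \<beta> * \<gamma> + \<beta> * \<gamma> * (\<beta> * \<gamma>)) (- (\<beta> * \<gamma> * \<beta>)) (\<beta> * \<gamma> * \<gamma>) (1 - \<beta> * \<gamma>)"
    have C: "?C ** (?L ** ?U) = ?U ** ?L"
      by (simp add: mat2_mult mat2_eq_iff algebra_simps)
    have SL2: "?C \<in> carrier (SL2 disc)" "?U \<in> carrier (SL2 disc)" "?L \<in> carrier (SL2 disc)"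
      unfolding mat2_SL2 SL_def using \<beta>\<gamma> by (simp_all add: algebra_simps)
    have "pm_I #>\<^bsub>SL2 disc\<^esub> ?C \<in> principal_congruence_subgroup disc \<pi>"
      unfolding principal_congruence_subgroup_def
    proof (intro CollectI conjI bexI[of _ ?C] disjI1)
      show "pm_I #>\<^bsub>SL2 disc\<^esub> ?C \<in> carrier (PSL2 disc)"
        using SL2 by (auto simp: PSL2_def carrier_FactGroup)
      show "?C \<in> pm_I #>\<^bsub>SL2 disc\<^esub> ?C"
        by (rule group.rcos_self[OF group_SL2 SL2(1) normal_imp_subgroup[OF normal_pm_I]])
      show "mat_cong \<pi> ?C (mat 1)"
        unfolding mat_cong_def mat2_one forall_2
        using \<pi>_mult[of "1 + \<beta> * \<gamma>"] \<pi>_mult[of "- \<beta>"] \<pi>_mult[of \<gamma>] \<pi>_mult[of "- 1"] \<beta>\<gamma>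
        by (simp add: algebra_simps)
    qed
    then have "Phi ?C = id" using \<pi>(3) N(3)[OF SL2(1)] by blast
    then have comm: "Phi ?U \<circ> Phi ?L = Phi ?L \<circ> Phi ?U"
      using Phi_mult[OF SL2(1) SL2_closed[OF SL2(3,2)]] C Phi_mult SL2 by simp
    have U: "Phi ?U = u x"
      unfolding Phi_U[OF \<beta>\<gamma>(1)] unfolding \<beta>_def by (rule u_cong) (use xy e in auto)
    have "q dvd (1 - e) - 1" using e by simp
    have "?L = - (?S ** (mat2 1 (- \<gamma>) 0 1 ** ?S))" by (simp add: mat2_mult mat2_uminus)
    then have "Phi ?L = Phi (?S ** (mat2 1 (- \<gamma>) 0 1 ** ?S))"
      using Phi_uminus S_SL2 U_SL2[of "- \<gamma>"] \<beta>\<gamma> SL2_closed by simp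
    also have "\<dots> = s \<circ> (u (- \<gamma>) \<circ> s)"
      using Phi_S_mult[of "mat2 1 (- \<gamma>) 0 1 ** ?S"] Phi_U_mult[of "- \<gamma>" ?S] Phi_S S_SL2
        U_SL2[of "- \<gamma>"] \<beta>\<gamma> SL2_closed by simp
    also have "u (- \<gamma>) = u y"
      unfolding \<gamma>_def minus_minus
      by (rule u_cong[OF xy(2,4)]) (use \<open>q dvd (1 - e) - 1\<close> in simp)
    finally have L: "Phi ?L = s \<circ> u y \<circ> s" by (simp add: fun_eq_iff)
    show False using comm neq unfolding U L by simp
  qed
  then have "noncongruence_subgroup disc N"
    using N normal_imp_subgroup unfolding noncongruence_subgroup_def congruence_subgroup_def by blast
  then show ?thesis using N(1) by blast
qed

lemma finite_image:
  assumes "finite X" "s permutes X" "\<And>x. x \<in> \<O> \<Longrightarrow> u x permutes X" "\<And>\<epsilon>. unit \<epsilon> \<Longrightarrow> D \<epsilon> permutes X"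
  shows "finite (Phi ` carrier (SL2 disc))"
proof (rule finite_subset[OF _ finite_permutations[OF assms(1)]], safe)
  fix A assume "A \<in> carrier (SL2 disc)"
  then show "Phi A permutes X"
  proof (induction A rule: SL2_induct)
    case (upper x \<epsilon>)
    then show ?case
      using Phi_U_mult[OF _ D_SL2] Phi_D assms permutes_compose by metis
  next
    case (step q A)
    then show ?case
      using Phi_U_mult Phi_S_mult S_SL2 SL2_closed assms permutes_compose by metis
  qed
qed

end

section \<open>Actions from finitely many relations\<close>

lemma funpow_eq_if_cong:
  assumes "f ^^ k = id" "i mod k = j mod k"
  shows "f ^^ i = f ^^ j"
  using assms funpow_mod_eq[of k f] by (metis (no_types) eq_id_iff ext)

text \<open>Integer powers of a map whose \<open>k\<close>-th power is the identity. Reducing the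
  exponent avoids inverse functions and carries over to an executable form.\<close>

definition zpow :: "nat \<Rightarrow> ('a \<Rightarrow> 'a) \<Rightarrow> int \<Rightarrow> 'a \<Rightarrow> 'a" where
  "zpow k f m = f ^^ nat (m mod int k)"

definition zpow2 :: "nat \<Rightarrow> ('a \<Rightarrow> 'a) \<Rightarrow> ('a \<Rightarrow> 'a) \<Rightarrow> int \<Rightarrow> int \<Rightarrow> 'a \<Rightarrow> 'a" where
  "zpow2 k U V m n = zpow k U m \<circ> zpow k V n"

lemma zpow_0 [simp]: "zpow k f 0 = id"
  by (simp add: zpow_def)

lemma zpow_1 [simp]: "k > 1 \<Longrightarrow> zpow k f 1 = f"
  by (simp add: zpow_def)

lemma zpow_add:
  assumes "f ^^ k = id" "k > 0"
  shows "zpow k f (m + n) = zpow k f m \<circ> zpow k f n"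
proof -
  have "nat ((m + n) mod int k) mod k = (nat (m mod int k) + nat (n mod int k)) mod k"
  proof -
    have "int (nat ((m + n) mod int k) mod k) = int ((nat (m mod int k) + nat (n mod int k)) mod k)"
      using assms(2) by (simp add: zmod_int mod_add_eq)
    then show ?thesis by (simp only: of_nat_eq_iff)
  qed
  then show ?thesis
    unfolding zpow_def funpow_add[symmetric] by (rule funpow_eq_if_cong[OF assms(1)])
qed

lemma funpow_permutes: "f permutes X \<Longrightarrow> f ^^ j permutes X"
  by (induction j) (auto simp: permutes_id intro: permutes_compose)

lemma zpow_permutes: "f permutes X \<Longrightarrow> zpow k f m permutes X"
  unfolding zpow_def by (rule funpow_permutes)

context euclidean_quadratic
begin

section \<open>Units as powers of \<open>\<zeta>\<close>\<close>

lemma unit_power: "unit (\<zeta> ^ j)"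
  by (induction j) (auto simp: unit_def norm_mult)

lemma zeta_half_order: "\<zeta> ^ nat (2 + t) = - 1"
  using t_cases by (elim disjE) (simp_all add: eval_nat_numeral zeta_square right_diff_distrib)

lemma unit_cases:
  assumes "unit \<epsilon>"
  obtains j where "\<epsilon> = \<zeta> ^ j"
proof -
  obtain m n where \<epsilon>: "\<epsilon> = of_int m + of_int n * \<zeta>"
    using assms O_cases unfolding unit_def by metis
  have "(cmod \<epsilon>)\<^sup>2 = 1" using assms by (simp add: unit_def)
  then have 1: "m\<^sup>2 + t * m * n + n\<^sup>2 = 1"
    unfolding \<epsilon> cmod_O by linarith
  have "2 * (m\<^sup>2 + t * m * n + n\<^sup>2) = m\<^sup>2 + n\<^sup>2 + (if t = 0 then m\<^sup>2 + n\<^sup>2 else (m + n)\<^sup>2)"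
    using t_cases by (auto simp: power2_eq_square algebra_simps)
  then have "m\<^sup>2 + n\<^sup>2 \<le> 2" using 1 by (smt (verit) zero_le_power2)
  then have "m\<^sup>2 < 4" "n\<^sup>2 < 4" by (smt (verit) zero_le_power2)+
  then have "\<bar>m\<bar> < 2" "\<bar>n\<bar> < 2"
    using power2_less_imp_less[of "\<bar>m\<bar>" 2] power2_less_imp_less[of "\<bar>n\<bar>" 2] by auto
  then have mn: "m \<in> {-1, 0, 1}" "n \<in> {-1, 0, 1}" by auto
  have "\<epsilon> \<in> {1, \<zeta>, \<zeta> * \<zeta>, - 1, - \<zeta>, - (\<zeta> * \<zeta>)}"
    using t_cases
  proof
    assume "t = 0" then show ?thesis using mn 1 unfolding zeta_square \<epsilon> by auto
  next
    assume "t = 1" then show ?thesis using mn 1 unfolding zeta_square \<epsilon> by auto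
  qed
  moreover have "- (\<zeta> ^ j) = \<zeta> ^ (nat (2 + t) + j)" for j
    by (simp only: power_add zeta_half_order) simp
  ultimately have "\<exists>j. \<epsilon> = \<zeta> ^ j"
    by (metis empty_iff insert_iff power_0 power_one_right power2_eq_square)
  then show thesis using that by blast
qed

lemma Im_zeta_power: "0 < r \<Longrightarrow> r < nat (2 + t) \<Longrightarrow> Im (\<zeta> ^ r) > 0"
proof -
  assume "0 < r" "r < nat (2 + t)"
  then have "r = 1 \<or> r = 2 \<and> t = 1" using t_cases by auto
  then show ?thesis using Im_zeta_pos zeta_square by (auto simp: power2_eq_square)
qed

text \<open>The powers of \<open>\<zeta>\<close> with exponent strictly between 0 and
  \<open>2 + t\<close> lie in the upper half plane, so none of them is 1 or -1. Divisibility by half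
  the order is enough for \<open>D\<close>, because D(-1) acts trivially.\<close>

lemma zeta_power_eq_1:
  assumes "\<zeta> ^ j = 1"
  shows "nat (2 + t) dvd j"
proof -
  let ?h = "nat (2 + t)"
  have "\<zeta> ^ j = (\<zeta> ^ ?h) ^ (j div ?h) * \<zeta> ^ (j mod ?h)"
    by (simp flip: power_mult power_add)
  then have "(- 1) ^ (j div ?h) * \<zeta> ^ (j mod ?h) = 1"
    using assms zeta_half_order by simp
  then have "\<zeta> ^ (j mod ?h) = 1 \<or> \<zeta> ^ (j mod ?h) = - 1"
    by (cases "even (j div ?h)") (auto simp: minus_equation_iff)
  then have "Im (\<zeta> ^ (j mod ?h)) = 0" by (elim disjE) simp_all
  moreover have "j mod ?h < ?h" using t_cases by auto
  ultimately have "j mod ?h = 0" using Im_zeta_power[of "j mod ?h"] by fastforce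
  then show ?thesis by presburger
qed

lemma O_induct [consumes 1, case_names one zeta add uminus]:
  assumes "x \<in> \<O>" and "P 1" "P \<zeta>"
    and add: "\<And>x y. x \<in> \<O> \<Longrightarrow> y \<in> \<O> \<Longrightarrow> P x \<Longrightarrow> P y \<Longrightarrow> P (x + y)"
    and uminus: "\<And>x. x \<in> \<O> \<Longrightarrow> P x \<Longrightarrow> P (- x)"
  shows "P x"
proof -
  have of_int: "P (of_int m * y)" if y: "y \<in> \<O>" "P y" for m y
  proof (induction m rule: int_induct[where k = 0])
    case base
    then show ?case using add[OF y(1) _ y(2) uminus[OF y]] y(1) by simp
  next
    case (step1 i)
    then show ?case using add[OF _ y(1) step1(2) y(2)] y by (simp add: algebra_simps)
  next
    case (step2 i)
    then show ?case using add[OF _ _ step2(2) uminus[OF y]] y by (simp add: algebra_simps)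
  qed
  obtain m n where "x = of_int m + of_int n * \<zeta>" using assms(1) by (rule O_cases)
  then show ?thesis
    using add[OF _ _ of_int[OF O_1 \<open>P 1\<close>, of m] of_int[OF zeta_O \<open>P \<zeta>\<close>, of n]] by simp
qed

end

text \<open>U, V, s and d are the images of U(1), U(\<zeta>), S and D(\<zeta>). The arguments of
  \<open>zpow2\<close> are coordinates in the basis 1, \<zeta>: of the square and cube of \<zeta> in
  \<open>dU\<close> and \<open>dV\<close>, and of -1 and -1/\<zeta> in \<open>sU\<close> and
  \<open>sV\<close>. The exponent \<open>1 + t\<close> stems from
  \<open>1 / \<zeta> = - (\<zeta> ^ nat (1 + t))\<close>.\<close>

locale sl2_model = euclidean_quadratic +
  fixes k :: nat and U V s d :: "'a \<Rightarrow> 'a"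
  assumes k: "k > 1"
    and U: "U ^^ k = id" and V: "V ^^ k = id" and UV: "U \<circ> V = V \<circ> U"
    and ss: "s \<circ> s = id" and sd: "s \<circ> d \<circ> s \<circ> d = id" and d: "d ^^ nat (2 + t) = id"
    and dU: "d \<circ> U = zpow2 k U V (- 1) t \<circ> d" and dV: "d \<circ> V = zpow2 k U V (- t) (t - 1) \<circ> d"
    and sU: "s \<circ> U \<circ> s = zpow2 k U V (- 1) 0 \<circ> s \<circ> zpow2 k U V (- 1) 0"
    and sV: "s \<circ> V \<circ> s = zpow2 k U V (- t) 1 \<circ> d ^^ nat (1 + t) \<circ> s \<circ> zpow2 k U V (- t) 1"
begin

abbreviation up :: "int \<Rightarrow> int \<Rightarrow> 'a \<Rightarrow> 'a" where
  "up \<equiv> zpow2 k U V"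

text \<open>The coordinates of \<open>x\<close> in the basis 1, \<zeta> are recovered from its real
  and imaginary parts; on \<open>\<O>\<close> the floors are exact.\<close>

definition u :: "complex \<Rightarrow> 'a \<Rightarrow> 'a" where
  "u x = (let n = \<lfloor>Im x / Im \<zeta>\<rfloor> in up \<lfloor>Re x - of_int n * Re \<zeta>\<rfloor> n)"

text \<open>Any exponent representing \<epsilon> gives the same map, by
  \<open>D_power\<close>.\<close>

definition D :: "complex \<Rightarrow> 'a \<Rightarrow> 'a" where
  "D \<epsilon> = d ^^ (LEAST j. \<zeta> ^ j = \<epsilon>)"

section \<open>From the relations for 1 and \<open>\<zeta>\<close> to those for all elements and
  units\<close>

lemma u_eq: "u (of_int m + of_int n * \<zeta>) = up m n"
  using Im_zeta_pos by (simp add: u_def)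

lemma u_of_int: "u (of_int m) = zpow k U m"
  using u_eq[of m 0] by (simp add: zpow2_def)

lemma u_of_int_zeta: "u (of_int n * \<zeta>) = zpow k V n"
  using u_eq[of 0 n] by (simp add: zpow2_def)

lemma u_1: "u 1 = U" and u_zeta: "u \<zeta> = V"
  using u_of_int[of 1] u_of_int_zeta[of 1] k by simp_all

lemma D_power: "D (\<zeta> ^ j) = d ^^ j"
proof -
  define i where "i = (LEAST i. \<zeta> ^ i = \<zeta> ^ j)"
  have "\<zeta> ^ i = \<zeta> ^ j" "i \<le> j" unfolding i_def by (auto intro: LeastI Least_le)
  then have "\<zeta> ^ (j - i) = 1" by (simp add: power_diff)
  then have "nat (2 + t) dvd j - i" by (rule zeta_power_eq_1)
  then have "d ^^ i = d ^^ j"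
    using \<open>i \<le> j\<close> by (intro funpow_eq_if_cong[OF d]) (metis mod_eq_dvd_iff_nat)
  then show ?thesis by (simp add: D_def i_def)
qed

lemma D_1: "D 1 = id"
  using D_power[of 0] by simp

lemma D_m1: "D (- 1) = id"
  using D_power[of "nat (2 + t)"] d zeta_half_order by simp

lemma D_mult: "unit \<epsilon> \<Longrightarrow> unit \<eta> \<Longrightarrow> D (\<epsilon> * \<eta>) = D \<epsilon> \<circ> D \<eta>"
  by (elim unit_cases) (simp add: D_power funpow_add flip: power_add)

lemma zpow_commute: "zpow k U m \<circ> zpow k V n = zpow k V n \<circ> zpow k U m"
proof -
  have UV': "U \<circ> V ^^ j = V ^^ j \<circ> U" for j
    by (induction j) (use UV in \<open>auto simp: fun_eq_iff\<close>)
  have "U ^^ i \<circ> V ^^ j = V ^^ j \<circ> U ^^ i" for i j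
    by (induction i) (use UV' in \<open>auto simp: fun_eq_iff\<close>)
  then show ?thesis by (simp add: zpow_def)
qed

lemma up_add: "up (m + m') (n + n') = up m n \<circ> up m' n'"
proof -
  have "up (m + m') (n + n') = zpow k U m \<circ> (zpow k U m' \<circ> zpow k V n) \<circ> zpow k V n'"
    using k by (simp add: zpow2_def zpow_add U V comp_assoc)
  then show ?thesis unfolding zpow_commute by (simp add: zpow2_def comp_assoc)
qed

lemma u_add: "x \<in> \<O> \<Longrightarrow> y \<in> \<O> \<Longrightarrow> u (x + y) = u x \<circ> u y"
proof (elim O_cases)
  fix m n m' n' assume *: "x = of_int m + of_int n * \<zeta>" "y = of_int m' + of_int n' * \<zeta>"
  have "x + y = of_int (m + m') + of_int (n + n') * \<zeta>" by (simp add: * algebra_simps)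
  then show ?thesis unfolding * by (simp only: u_eq up_add)
qed

lemma u_0: "u 0 = id"
  using u_of_int[of 0] by simp

text \<open>Multiplication by the square of \<zeta> is additive and \<open>u\<close> turns sums into
  compositions, so the relations \<open>dU\<close> and \<open>dV\<close> for the additive generators
  suffice.\<close>

lemma D_zeta_u: "x \<in> \<O> \<Longrightarrow> d \<circ> u x = u (\<zeta> * \<zeta> * x) \<circ> d"
proof (induction x rule: O_induct)
  case one
  then show ?case using dU u_eq[of "- 1" t] by (simp add: zeta_square u_1)
next
  case zeta
  have "\<zeta> * \<zeta> * \<zeta> = (of_int t * \<zeta> - 1) * \<zeta>" by (simp only: zeta_square)
  also have "\<dots> = of_int t * (\<zeta> * \<zeta>) - \<zeta>" by (simp add: algebra_simps)
  also have "\<dots> = of_int (- t) + of_int (t - 1) * \<zeta>"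
    using t_cases by (auto simp: zeta_square algebra_simps)
  finally show ?case using dV by (simp only: u_eq u_zeta)
next
  case (add x y)
  then show ?case using u_add by (simp add: distrib_left) (simp add: fun_eq_iff)
next
  case (uminus x)
  let ?y = "\<zeta> * \<zeta> * x"
  have inv: "u (- z) \<circ> u z = id" "u z \<circ> u (- z) = id" if "z \<in> \<O>" for z
    using u_add[of z "- z"] u_add[of "- z" z] u_0 that by simp_all
  have "d \<circ> u (- x) = (u (- ?y) \<circ> u ?y) \<circ> d \<circ> u (- x)"
    using inv uminus(1) by simp
  also have "\<dots> = u (- ?y) \<circ> (d \<circ> u x) \<circ> u (- x)"
    unfolding uminus(2) by (simp only: comp_assoc)
  also have "\<dots> = u (- ?y) \<circ> d" using inv(2)[OF uminus(1)] by (simp add: comp_assoc)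
  finally show ?case by simp
qed

lemma D_u: "unit \<epsilon> \<Longrightarrow> x \<in> \<O> \<Longrightarrow> D \<epsilon> \<circ> u x = u (\<epsilon> * \<epsilon> * x) \<circ> D \<epsilon>"
proof (elim unit_cases)
  fix j assume x: "x \<in> \<O>" and \<epsilon>: "\<epsilon> = \<zeta> ^ j"
  have "d ^^ j \<circ> u x = u (\<zeta> ^ j * \<zeta> ^ j * x) \<circ> d ^^ j"
  proof (induction j)
    case (Suc j)
    have "d ^^ Suc j \<circ> u x = d \<circ> (d ^^ j \<circ> u x)" by (simp add: comp_assoc)
    also have "\<dots> = d \<circ> u (\<zeta> ^ j * \<zeta> ^ j * x) \<circ> d ^^ j" by (simp only: Suc comp_assoc)
    also have "\<dots> = u (\<zeta> * \<zeta> * (\<zeta> ^ j * \<zeta> ^ j * x)) \<circ> d ^^ Suc j"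
      using D_zeta_u[of "\<zeta> ^ j * \<zeta> ^ j * x"] x unit_O[OF unit_power] by (simp add: comp_assoc)
    finally show ?case by (simp add: ac_simps del: funpow.simps)
  qed simp
  then show ?thesis by (simp add: \<epsilon> D_power)
qed

lemma inverse_zeta_power: "1 / \<zeta> = - (\<zeta> ^ nat (1 + t))"
proof -
  have "nat (2 + t) = Suc (nat (1 + t))" using t_cases by auto
  then have "\<zeta> * - (\<zeta> ^ nat (1 + t)) = 1" using zeta_half_order by simp
  then show ?thesis by (simp add: field_simps)
qed

lemma D_inverse_zeta: "D (1 / \<zeta>) = d ^^ nat (1 + t)"
  using D_mult[OF unit_m1 unit_power, of "nat (1 + t)"] D_m1
  by (simp add: inverse_zeta_power D_power)

lemma unit_zeta: "unit \<zeta>"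
  by (simp add: unit_def)

lemma D_zeta: "D \<zeta> = d"
  using D_power[of 1] by simp

lemma s_d: "s \<circ> d = D (1 / \<zeta>) \<circ> s"
proof -
  have "D (1 / \<zeta>) \<circ> d = id"
    using D_mult[OF unit_inverse[OF unit_zeta] unit_zeta] D_1 D_zeta by simp
  moreover have "d \<circ> (s \<circ> d) = s"
    using arg_cong[OF sd, of "\<lambda>f. s \<circ> f"] ss by (simp add: comp_assoc[symmetric])
  ultimately show ?thesis by (metis comp_assoc id_comp)
qed

lemma s_D: "unit \<epsilon> \<Longrightarrow> s \<circ> D \<epsilon> = D (1 / \<epsilon>) \<circ> s"
proof (elim unit_cases)
  fix j assume \<epsilon>: "\<epsilon> = \<zeta> ^ j"
  have "s \<circ> d ^^ j = D (1 / \<zeta> ^ j) \<circ> s"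
  proof (induction j)
    case 0
    then show ?case by (simp add: D_1)
  next
    case (Suc j)
    have "s \<circ> d ^^ Suc j = (s \<circ> d) \<circ> d ^^ j" by (simp add: comp_assoc)
    also have "\<dots> = D (1 / \<zeta>) \<circ> (s \<circ> d ^^ j)" by (simp only: s_d comp_assoc)
    also have "\<dots> = D (1 / \<zeta> * (1 / \<zeta> ^ j)) \<circ> s"
      using D_mult[OF unit_inverse[OF unit_zeta] unit_inverse[OF unit_power]]
      by (simp only: Suc comp_assoc)
    finally show ?case by (simp del: funpow.simps)
  qed
  then show ?thesis by (simp add: \<epsilon> D_power)
qed

text \<open>Conjugation by D(\<epsilon>) carries the relation for \<eta> to that for
  \<epsilon>\<epsilon>\<eta>. Every unit is 1 or \<zeta> times the square of a unit, so the
  relations \<open>sU\<close> and \<open>sV\<close> yield all the others.\<close>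

lemma s_u_s_step:
  assumes "unit \<eta>" "unit \<epsilon>"
    and \<eta>: "s \<circ> u \<eta> \<circ> s = u (- 1 / \<eta>) \<circ> D (1 / \<eta>) \<circ> s \<circ> u (- 1 / \<eta>)"
  shows "s \<circ> u (\<epsilon> * \<epsilon> * \<eta>) \<circ> s
    = u (- 1 / (\<epsilon> * \<epsilon> * \<eta>)) \<circ> D (1 / (\<epsilon> * \<epsilon> * \<eta>)) \<circ> s \<circ> u (- 1 / (\<epsilon> * \<epsilon> * \<eta>))"
proof -
  define y where "y = - 1 / (\<epsilon> * \<epsilon> * \<eta>)"
  have [simp]: "\<epsilon> \<noteq> 0" "\<eta> \<noteq> 0" using assms unit_neq_0 by auto
  have inv: "unit (1 / \<epsilon>)" "unit (1 / \<eta>)" using assms unit_inverse by auto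
  have "y = (- 1) * (1 / \<epsilon>) * (1 / \<epsilon>) * (1 / \<eta>)" by (simp add: y_def)
  then have y: "y \<in> \<O>" "- 1 / \<eta> \<in> \<O>"
    using inv unit_O O_uminus[of "1 / \<eta>"] by (auto simp del: mult_minus1 times_divide_eq_right times_divide_eq_left mult_1_right)
  have D\<epsilon>: "D \<epsilon> \<circ> D (1 / \<epsilon>) = id"
    using D_mult[OF assms(2) inv(1)] D_1 by simp
  have "s \<circ> u (\<epsilon> * \<epsilon> * \<eta>) \<circ> s = s \<circ> (u (\<epsilon> * \<epsilon> * \<eta>) \<circ> D \<epsilon>) \<circ> D (1 / \<epsilon>) \<circ> s"
    using D\<epsilon> by (simp add: comp_assoc)
  also have "\<dots> = (s \<circ> D \<epsilon>) \<circ> u \<eta> \<circ> (D (1 / \<epsilon>) \<circ> s)"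
    using D_u[OF assms(2) unit_O[OF assms(1)]] by (simp add: comp_assoc)
  also have "\<dots> = D (1 / \<epsilon>) \<circ> (s \<circ> u \<eta> \<circ> s) \<circ> D \<epsilon>"
    using s_D[OF assms(2)] by (simp add: comp_assoc)
  also have "\<dots> = (D (1 / \<epsilon>) \<circ> u (- 1 / \<eta>)) \<circ> D (1 / \<eta>) \<circ> s \<circ> (u (- 1 / \<eta>) \<circ> D \<epsilon>)"
    unfolding \<eta> by (simp add: comp_assoc)
  also have "D (1 / \<epsilon>) \<circ> u (- 1 / \<eta>) = u y \<circ> D (1 / \<epsilon>)"
    using D_u[OF inv(1) y(2)] by (simp add: y_def)
  also have "u (- 1 / \<eta>) \<circ> D \<epsilon> = D \<epsilon> \<circ> u y"
    using D_u[OF assms(2) y(1)] by (simp add: y_def)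
  also have "u y \<circ> D (1 / \<epsilon>) \<circ> D (1 / \<eta>) \<circ> s \<circ> (D \<epsilon> \<circ> u y)
      = u y \<circ> (D (1 / \<epsilon>) \<circ> D (1 / \<eta>)) \<circ> (s \<circ> D \<epsilon>) \<circ> u y"
    by (simp add: comp_assoc)
  also have "\<dots> = u y \<circ> (D (1 / \<epsilon>) \<circ> D (1 / \<eta>) \<circ> D (1 / \<epsilon>)) \<circ> s \<circ> u y"
    unfolding s_D[OF assms(2)] by (simp add: comp_assoc)
  also have "D (1 / \<epsilon>) \<circ> D (1 / \<eta>) \<circ> D (1 / \<epsilon>) = D (1 / \<epsilon> * (1 / \<eta>) * (1 / \<epsilon>))"
    using inv by (simp only: D_mult unit_mult)
  also have "1 / \<epsilon> * (1 / \<eta>) * (1 / \<epsilon>) = 1 / (\<epsilon> * \<epsilon> * \<eta>)" by simp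
  finally show ?thesis unfolding y_def .
qed

lemma s_u_s: "unit \<epsilon> \<Longrightarrow> s \<circ> u \<epsilon> \<circ> s = u (- 1 / \<epsilon>) \<circ> D (1 / \<epsilon>) \<circ> s \<circ> u (- 1 / \<epsilon>)"
proof (elim unit_cases)
  fix j assume \<epsilon>: "\<epsilon> = \<zeta> ^ j"
  have 1: "s \<circ> u 1 \<circ> s = u (- 1 / 1) \<circ> D (1 / 1) \<circ> s \<circ> u (- 1 / 1)"
    using sU u_eq[of "- 1" 0] by (simp add: u_1 D_1)
  have "- 1 / \<zeta> = of_int (- t) + of_int 1 * \<zeta>" using inverse_zeta by simp
  then have \<zeta>: "s \<circ> u \<zeta> \<circ> s = u (- 1 / \<zeta>) \<circ> D (1 / \<zeta>) \<circ> s \<circ> u (- 1 / \<zeta>)"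
    using sV by (simp only: u_eq u_zeta D_inverse_zeta)
  show ?thesis
  proof (cases "even j")
    case True
    then obtain i where "j = 2 * i" by (elim evenE)
    then have "\<epsilon> = \<zeta> ^ i * \<zeta> ^ i * 1" using \<epsilon> by (simp add: mult_2 power_add)
    then show ?thesis using s_u_s_step[OF unit_1 unit_power 1] by simp
  next
    case False
    then obtain i where "j = 2 * i + 1" by (elim oddE)
    then have "\<epsilon> = \<zeta> ^ i * \<zeta> ^ i * \<zeta>" using \<epsilon> by (simp add: mult_2 power_add)
    then show ?thesis using s_u_s_step[OF unit_zeta unit_power \<zeta>] by simp
  qed
qed

sublocale sl2_relations t \<zeta> u s D
  by unfold_locales (use u_0 u_add ss D_1 D_m1 D_mult D_u s_D s_u_s in auto)

lemma finite_model:
  assumes "finite X" "s permutes X" "d permutes X" "U permutes X" "V permutes X"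
  shows "finite (Phi ` carrier (SL2 disc))"
proof (rule finite_image[OF assms(1,2)])
  show "u x permutes X" for x
    unfolding u_def Let_def zpow2_def using assms by (intro permutes_compose zpow_permutes)
  show "D \<epsilon> permutes X" for \<epsilon>
    unfolding D_def using assms(3) by (rule funpow_permutes)
qed

end

section \<open>The permutations\<close>

text \<open>A permutation of an initial segment is encoded by its list of values, so that relations
  between permutations become equalities of lists, decided by evaluation.\<close>

definition list_perm :: "nat list \<Rightarrow> nat \<Rightarrow> nat" where
  "list_perm xs i = (if i < length xs then xs ! i else i)"

definition list_comp :: "nat list \<Rightarrow> nat list \<Rightarrow> nat list" where
  "list_comp xs ys = map ((!) xs) ys"

definition perm_list :: "nat \<Rightarrow> nat list \<Rightarrow> bool" where
  "perm_list n xs \<longleftrightarrow> length xs = n \<and> list_all (\<lambda>i. i < n) xs \<and> distinct xs"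

lemma list_perm_comp:
  assumes "perm_list n xs" "perm_list n ys"
  shows "list_perm xs \<circ> list_perm ys = list_perm (list_comp xs ys)"
  using assms by (auto simp: fun_eq_iff list_perm_def list_comp_def perm_list_def list_all_length)

lemma perm_list_comp:
  assumes "perm_list n xs" "perm_list n ys"
  shows "perm_list n (list_comp xs ys)"
  using assms by (auto simp: list_comp_def perm_list_def list_all_length distinct_map inj_on_def
      in_set_conv_nth nth_eq_iff_index_eq)

lemma perm_list_upt: "perm_list n [0..<n]"
  by (auto simp: perm_list_def list_all_length)

lemma list_perm_upt: "list_perm [0..<n] = id"
  by (auto simp: fun_eq_iff list_perm_def)

lemma list_perm_funpow:
  assumes "perm_list n xs"
  shows "list_perm xs ^^ j = list_perm ((list_comp xs ^^ j) [0..<n]) \<and>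
    perm_list n ((list_comp xs ^^ j) [0..<n])"
  by (induction j) (use assms in \<open>auto simp: perm_list_upt list_perm_upt list_perm_comp perm_list_comp\<close>)

lemma list_perm_permutes:
  assumes "perm_list n xs"
  shows "list_perm xs permutes {..<n}"
proof (rule bij_imp_permutes)
  have "inj_on (list_perm xs) {..<n}" "list_perm xs ` {..<n} \<subseteq> {..<n}"
    using assms by (auto simp: inj_on_def list_perm_def perm_list_def list_all_length nth_eq_iff_index_eq)
  then show "bij_betw (list_perm xs) {..<n} {..<n}"
    using endo_inj_surj[OF finite_lessThan] by (simp add: bij_betw_def)
  show "list_perm xs i = i" if "i \<notin> {..<n}" for i
    using that assms by (simp add: list_perm_def perm_list_def)
qed

lemma list_perm_eq_iff:
  assumes "perm_list n xs" "perm_list n ys"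
  shows "list_perm xs = list_perm ys \<longleftrightarrow> xs = ys"
proof
  assume *: "list_perm xs = list_perm ys"
  show "xs = ys"
  proof (rule nth_equalityI)
    show "length xs = length ys" using assms by (simp add: perm_list_def)
    show "xs ! i = ys ! i" if "i < length xs" for i
      using that assms fun_cong[OF *, of i] by (simp add: list_perm_def perm_list_def)
  qed
qed simp

section \<open>Relations checked by evaluation\<close>

definition list_zpow2 :: "nat \<Rightarrow> nat \<Rightarrow> nat list \<Rightarrow> nat list \<Rightarrow> int \<Rightarrow> int \<Rightarrow> nat list" where
  "list_zpow2 n k U V a b = list_comp ((list_comp U ^^ nat (a mod int k)) [0..<n])
     ((list_comp V ^^ nat (b mod int k)) [0..<n])"

lemma list_zpow2:
  assumes "perm_list n U" "perm_list n V"
  shows "zpow2 k (list_perm U) (list_perm V) a b = list_perm (list_zpow2 n k U V a b)"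
    and "perm_list n (list_zpow2 n k U V a b)"
  using list_perm_funpow[OF assms(1)] list_perm_funpow[OF assms(2)]
  by (simp_all add: zpow2_def zpow_def list_zpow2_def list_perm_comp[of n] perm_list_comp)

definition sl2_lists ::
  "nat \<Rightarrow> nat \<Rightarrow> int \<Rightarrow> nat list \<Rightarrow> nat list \<Rightarrow> nat list \<Rightarrow> nat list \<Rightarrow> bool" where
  "sl2_lists n k t U V s d \<longleftrightarrow>
     (let one = [0..<n]; up = list_zpow2 n k U V in
       k > 1 \<and> list_all (perm_list n) [U, V, s, d] \<and>
       (list_comp U ^^ k) one = one \<and> (list_comp V ^^ k) one = one \<and>
       (list_comp d ^^ nat (2 + t)) one = one \<and>
       list_comp U V = list_comp V U \<and> list_comp s s = one \<and>
       list_comp (list_comp (list_comp s d) s) d = one \<and>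
       list_comp d U = list_comp (up (- 1) t) d \<and>
       list_comp d V = list_comp (up (- t) (t - 1)) d \<and>
       list_comp (list_comp s U) s = list_comp (list_comp (up (- 1) 0) s) (up (- 1) 0) \<and>
       list_comp (list_comp s V) s = list_comp (list_comp (list_comp (up (- t) 1)
         ((list_comp d ^^ nat (1 + t)) one)) s) (up (- t) 1))"

context euclidean_quadratic
begin

lemma sl2_model_of_lists:
  assumes "sl2_lists n k t U V s d"
  shows "sl2_model t \<zeta> k (list_perm U) (list_perm V) (list_perm s) (list_perm d)"
proof -
  note * = assms[unfolded sl2_lists_def Let_def]
  have pl: "perm_list n U" "perm_list n V" "perm_list n s" "perm_list n d"
    using * by auto
  note list_perm_hom = pl list_zpow2[of n, OF pl(1,2)] list_perm_comp[of n] perm_list_comp[of n]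
    list_perm_funpow[of n, THEN conjunct1] list_perm_funpow[of n, THEN conjunct2]
  show ?thesis
  proof
    show "k > 1" using * by blast
  qed (simp_all only: list_perm_hom * list_perm_upt)
qed

text \<open>The form of \<open>noncongruence\<close> for x = a + b\<zeta> and y = a' + b'\<zeta> in
  which the conditions on orders and on non-commutation are statements about lists.\<close>

lemma noncongruence_of_lists:
  fixes p q :: int
  assumes lists: "sl2_lists n k t U V s d"
    and pq: "prime p" "\<not> p dvd q" "q \<noteq> 0"
    and id: "list_zpow2 n k U V (p * a) (p * b) = [0..<n]"
      "list_zpow2 n k U V (q * a') (q * b') = [0..<n]"
    and neq: "(let X = list_zpow2 n k U V a b;
      Y = list_comp (list_comp s (list_zpow2 n k U V a' b')) s in list_comp X Y \<noteq> list_comp Y X)"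
  shows "\<exists>N. N \<lhd> PSL2 disc \<and> noncongruence_subgroup disc N"
proof -
  interpret M: sl2_model t \<zeta> k "list_perm U" "list_perm V" "list_perm s" "list_perm d"
    by (rule sl2_model_of_lists[OF lists])
  have pl: "perm_list n U" "perm_list n V" "perm_list n s" "perm_list n d"
    using lists by (auto simp: sl2_lists_def Let_def)
  let ?x = "of_int a + of_int b * \<zeta>" and ?y = "of_int a' + of_int b' * \<zeta>"
  have mult: "of_int c * (of_int m + of_int l * \<zeta>) = of_int (c * m) + of_int (c * l) * \<zeta>" for c m l
    by (simp add: algebra_simps)
  show ?thesis
  proof (rule M.noncongruence[OF _ pq])
    show "finite (M.Phi ` carrier (SL2 disc))"
      by (rule M.finite_model[OF finite_lessThan]) (use pl list_perm_permutes in blast)+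
    show "?x \<in> \<O>" "?y \<in> \<O>" by (rule in_O)+
    show "M.u (of_int p * ?x) = id" "M.u (of_int q * ?y) = id"
      unfolding mult M.u_eq list_zpow2(1)[OF pl(1,2)] id by (rule list_perm_upt)+
    let ?X = "list_zpow2 n k U V a b" and ?Y = "list_comp (list_comp s (list_zpow2 n k U V a' b')) s"
    have XY: "M.u ?x = list_perm ?X" "list_perm s \<circ> M.u ?y \<circ> list_perm s = list_perm ?Y"
      "perm_list n ?X" "perm_list n ?Y"
      unfolding M.u_eq by (simp_all add: pl list_zpow2[of n] list_perm_comp[of n] perm_list_comp)
    show "M.u ?x \<circ> (list_perm s \<circ> M.u ?y \<circ> list_perm s)
        \<noteq> (list_perm s \<circ> M.u ?y \<circ> list_perm s) \<circ> M.u ?x"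
      unfolding XY(1,2) list_perm_comp[OF XY(3,4)] list_perm_comp[OF XY(4,3)]
      using neq list_perm_eq_iff[OF perm_list_comp[OF XY(3,4)] perm_list_comp[OF XY(4,3)]]
      by (simp add: Let_def)
  qed
qed

end

text \<open>The permutations were found by a search for subgroups of small index. In the second example
  \<open>U\<close> consists of three 5-cycles and one 7-cycle.\<close>

lemma sl2_lists_gauss:
  "sl2_lists 5 6 0 [0, 1, 4, 2, 3] [1, 0, 2, 3, 4] [0, 2, 1, 4, 3] [0, 1, 2, 4, 3]"
  by code_simp

lemma sl2_lists_eisenstein:
  "sl2_lists 22 35 1
     [2, 0, 4, 1, 3, 9, 5, 12, 14, 16, 6, 7, 8, 11, 15, 13, 10, 20, 19, 17, 21, 18]
     [3, 4, 1, 2, 0, 16, 9, 14, 13, 10, 5, 8, 15, 12, 11, 7, 6, 19, 21, 18, 17, 20]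
     [0, 5, 6, 7, 8, 1, 2, 3, 4, 11, 14, 9, 12, 17, 10, 18, 19, 13, 15, 16, 21, 20]
     [19, 20, 21, 18, 17, 2, 1, 11, 14, 3, 4, 15, 12, 8, 13, 7, 0, 10, 9, 16, 6, 5]"
  by code_simp

theorem proposition5p4:
  fixes d :: int and w :: complex
  assumes "d = -1 \<or> d = -3"
    and "integral_basis d w"
  shows "PSL2 d = PE2 d w \<and> (\<exists>N. N \<lhd> PSL2 d \<and> noncongruence_subgroup d N)"
  using assms(1)
proof
  assume d: "d = - 1"
  interpret euclidean_quadratic 0 \<i> by unfold_locales simp
  \<comment> \<open>V is a transposition and U a 3-cycle, so U(\<i>) and U(1) act with the coprime
    orders 2 and 3.\<close>
  have "\<exists>N. N \<lhd> PSL2 disc \<and> noncongruence_subgroup disc N"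
    by (rule noncongruence_of_lists[OF sl2_lists_gauss,
        where p = 2 and q = 3 and a = 0 and b = 1 and a' = 1 and b' = 0]) (simp, simp, simp, code_simp+)
  then show ?thesis using PSL2_eq_PE2[of w] assms(2) d by simp
next
  assume d: "d = - 3"
  interpret euclidean_quadratic 1 "Complex (1/2) (sqrt 3 / 2)" by unfold_locales simp
  \<comment> \<open>U has order 35, so U(7) acts with order 5 and U(5) with order 7: the 7th and 5th
    powers isolate its 5-cycles and its 7-cycle.\<close>
  have "\<exists>N. N \<lhd> PSL2 disc \<and> noncongruence_subgroup disc N"
    by (rule noncongruence_of_lists[OF sl2_lists_eisenstein,
        where p = 5 and q = 7 and a = 7 and b = 0 and a' = 5 and b' = 0]) (simp, simp, simp, code_simp+)
  then show ?thesis using PSL2_eq_PE2[of w] assms(2) d by simp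
qed

end
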